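(* Let $c(x,y)=|x-y|$ (or more generally $c(x,y)=|x-y|^p$ with $p>0$, $p\ne2$) on $\mathbb{R}^d\times\mathbb{R}^d$. Let $\mu\le_C\nu$ be probability measures on $\mathbb{R}^d$ such that $\mu$ is absolutely continuous with respect to the Lebesgue measure and $\nu$ is discrete, i.e. $\nu$ is supported on a countable set. If $\pi\in MT(\mu,\nu)$ is an optimizer for the problem of maximizing or minimizing $\int c\,d\pi$ over $MT(\mu,\nu)$, then for $\mu$-a.e. $x$, $\mathrm{supp}\,\pi_x$ consists of exactly $d+1$ points which are the vertices of a $d$-dimensional polytope in $\mathbb{R}^d$, and therefore the optimal solution is unique.
   Context: $\mu\le_C\nu$ (convex order): $\mu,\nu$ have finite first moments and $\int\varphi\,d\mu\le\int\varphi\,d\nu$ for every convex $\varphi$ on $\mathbb{R}^d$. $MT(\mu,\nu)$ is the set of probability measures $\pi$ on $\mathbb{R}^d\times\mathbb{R}^d$ with marginals $\mu$ and $\nu$ whose disintegration $d\pi(x,y)=d\pi_x(y)d\mu(x)$ has $\pi_x$ with barycenter $x$ for $\mu$-a.e. $x$. The minimization and the maximization problems are each covered separately (uniqueness is within the given problem).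
   Formalization: An optimizer is required to have finite cost ∫ c dπ, which is automatic for p ≤ 1; for p > 1, if ν lacks a finite p-th moment, every element of MT(μ,ν) may have infinite cost and so be an optimizer, and the claim as stated then fails. *)

theory Defs
  imports "HOL-Probability.Probability"
begin

text \<open>
  The integral of a real function as an element of the extended real line: the positive part minus
  the negative part (the coercion \<^const>\<open>ennreal\<close> truncates negative reals to 0).  Unlike the
  Bochner integral it does not collapse to 0 when it should be infinite.  If both parts are
  infinite, the value is a junk value; this never happens below, since convex functions have an
  affine minorant and the costs are nonnegative.
\<close>

definition ext_integral :: "'a measure \<Rightarrow> ('a \<Rightarrow> real) \<Rightarrow> ereal" where
  "ext_integral M f =
     enn2ereal (\<integral>\<^sup>+ x. ennreal (f x) \<partial>M) - enn2ereal (\<integral>\<^sup>+ x. ennreal (- f x) \<partial>M)"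

definition convex_order :: "'a::euclidean_space measure \<Rightarrow> 'a measure \<Rightarrow> bool" where
  "convex_order \<mu> \<nu> \<longleftrightarrow>
     integrable \<mu> (\<lambda>x. norm x) \<and> integrable \<nu> (\<lambda>y. norm y) \<and>
     (\<forall>\<phi>::'a \<Rightarrow> real. convex_on UNIV \<phi> \<longrightarrow> ext_integral \<mu> \<phi> \<le> ext_integral \<nu> \<phi>)"

definition concentrated_on_countable :: "'a measure \<Rightarrow> bool" where
  "concentrated_on_countable \<nu> \<longleftrightarrow> (\<exists>S. countable S \<and> (AE y in \<nu>. y \<in> S))"

text \<open>The topological support of a Borel measure.\<close>

definition msupport :: "'a::topological_space measure \<Rightarrow> 'a set" where
  "msupport M = {x. \<forall>U. open U \<longrightarrow> x \<in> U \<longrightarrow> emeasure M U > 0}"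

text \<open>
  \<open>\<kappa>\<close> is (a version of) the disintegration \<open>x \<mapsto> \<pi>\<^sub>x\<close> of \<open>\<pi>\<close> over its first marginal \<open>\<mu>\<close>:
  a Markov kernel with \<open>d\<pi>(x,y) = d\<pi>\<^sub>x(y) d\<mu>(x)\<close>, tested on rectangles.
\<close>

definition disintegration ::
  "'a::euclidean_space measure \<Rightarrow> ('a \<times> 'a) measure \<Rightarrow> ('a \<Rightarrow> 'a measure) \<Rightarrow> bool" where
  "disintegration \<mu> \<pi> \<kappa> \<longleftrightarrow>
     \<kappa> \<in> borel \<rightarrow>\<^sub>M prob_algebra borel \<and>
     (\<forall>A\<in>sets borel. \<forall>B\<in>sets borel.
        emeasure \<pi> (A \<times> B) = (\<integral>\<^sup>+ x. emeasure (\<kappa> x) B * indicator A x \<partial>\<mu>))"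

definition has_barycenter :: "'a::euclidean_space measure \<Rightarrow> 'a \<Rightarrow> bool" where
  "has_barycenter M b \<longleftrightarrow> integrable M (\<lambda>y. y) \<and> (LINT y|M. y) = b"

text \<open>
  Disintegrations of \<open>\<pi>\<close> exist and agree \<open>\<mu>\<close>-almost everywhere, so it is immaterial that the
  barycenter condition is imposed on some version rather than on all of them.
\<close>

definition MT :: "'a::euclidean_space measure \<Rightarrow> 'a measure \<Rightarrow> ('a \<times> 'a) measure set" where
  "MT \<mu> \<nu> = {\<pi>. prob_space \<pi> \<and> sets \<pi> = sets (borel \<Otimes>\<^sub>M borel) \<and>
     distr \<pi> borel fst = \<mu> \<and> distr \<pi> borel snd = \<nu> \<and>
     (\<exists>\<kappa>. disintegration \<mu> \<pi> \<kappa> \<and> (AE x in \<mu>. has_barycenter (\<kappa> x) x))}"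

definition transport_cost :: "('a \<Rightarrow> 'a \<Rightarrow> real) \<Rightarrow> ('a \<times> 'a) measure \<Rightarrow> ereal" where
  "transport_cost c \<pi> = ext_integral \<pi> (\<lambda>(x, y). c x y)"

text \<open>
  An optimizer attains a finite optimal value.  If the value is infinite the problem is degenerate:
  for \<open>c(x,y) = |x - y|\<^sup>p\<close> with \<open>p > 1\<close> and \<open>\<nu>\<close> without \<open>p\<close>-th moment, it can happen that every
  element of \<open>MT \<mu> \<nu>\<close> has infinite cost, and nothing distinguishes one from another.  For
  \<open>p \<le> 1\<close> finiteness is automatic since \<open>\<mu>\<close> and \<open>\<nu>\<close> have finite first moments.
  Competitors are not required to have finite cost.
\<close>

definition MT_minimizers ::
  "('a::euclidean_space \<Rightarrow> 'a \<Rightarrow> real) \<Rightarrow> 'a measure \<Rightarrow> 'a measure \<Rightarrow> ('a \<times> 'a) measure set" where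
  "MT_minimizers c \<mu> \<nu> = {\<pi> \<in> MT \<mu> \<nu>. \<bar>transport_cost c \<pi>\<bar> \<noteq> \<infinity> \<and>
     (\<forall>\<pi>'\<in>MT \<mu> \<nu>. transport_cost c \<pi> \<le> transport_cost c \<pi>')}"

definition MT_maximizers ::
  "('a::euclidean_space \<Rightarrow> 'a \<Rightarrow> real) \<Rightarrow> 'a measure \<Rightarrow> 'a measure \<Rightarrow> ('a \<times> 'a) measure set" where
  "MT_maximizers c \<mu> \<nu> = {\<pi> \<in> MT \<mu> \<nu>. \<bar>transport_cost c \<pi>\<bar> \<noteq> \<infinity> \<and>
     (\<forall>\<pi>'\<in>MT \<mu> \<nu>. transport_cost c \<pi>' \<le> transport_cost c \<pi>)}"

definition power_cost :: "real \<Rightarrow> 'a::euclidean_space \<Rightarrow> 'a \<Rightarrow> real" where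
  "power_cost p x y = norm (x - y) powr p"

end

theory Submission
  imports Defs "HOL-Complex_Analysis.Conformal_Mappings" "HOL-Real_Asymp.Real_Asymp"
begin

text \<open>
  Let \<open>S\<close> be a countable set carrying \<open>\<nu>\<close>.  For \<open>\<mu>\<close>-almost every \<open>x\<close> the conditional law \<open>\<pi>\<^sub>x\<close> is
  then carried by its atoms, which lie in \<open>S\<close>.  The claim is that these atoms form an affine basis of
  the space.

  They span, for optimal or non-optimal plans alike: otherwise \<open>x\<close>, being the barycenter of \<open>\<pi>\<^sub>x\<close>, lies
  on a hyperplane through finitely many points of \<open>S\<close>.  One hyperplane chosen for each finite subset of
  \<open>S\<close> that does not span makes countably many null sets
  (\<open>barycenter_off_hyperplanes_imp_full\<close>).

  They are affinely independent because of optimality.  An affinely dependent set contains a circuit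
  \<open>D\<close>, that is, a minimal affinely dependent set, with coefficients \<open>a\<^sub>z \<noteq> 0\<close> such that
  \<open>\<Sum> a\<^sub>z = 0\<close> and \<open>\<Sum> a\<^sub>z z = 0\<close>.  There are countably many candidates for \<open>D\<close>, so suppose that one
  fixed \<open>D\<close> consists of atoms of \<open>\<pi>\<^sub>x\<close>, with masses bounded below, for all \<open>x\<close> in a bounded set \<open>A\<close> of
  positive measure.  Adding \<open>h(x) \<Sum> a\<^sub>z \<delta>\<^sub>z\<close> to \<open>\<pi>\<^sub>x\<close>, for small \<open>h\<close> supported in \<open>A\<close> with
  \<open>\<integral> h d\<mu> = 0\<close>, keeps both marginals and the barycenters.  Since \<open>h\<close> and \<open>-h\<close> are both admissible, a
  minimizer and a maximizer alike satisfy \<open>\<integral> h F d\<mu> = 0\<close> with \<open>F(x) = \<Sum> a\<^sub>z |x - z|\<^sup>p\<close>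
  (\<open>optimal_stationary\<close>).  Taking \<open>h\<close> proportional to \<open>F\<close> minus its mean on \<open>A\<close> shows that \<open>F\<close> is
  almost everywhere constant on \<open>A\<close> (\<open>circuit_atoms_null\<close>).

  This contradicts \<open>\<mu> \<lless> Lebesgue\<close>, as the level sets of \<open>F\<close> are null
  (\<open>circuit_level_set_null\<close>).  In dimension at least two, a level set of positive measure meets some
  line in each direction \<open>v\<close> in infinitely many points of a bounded segment, and the line can be chosen
  to avoid \<open>D\<close>.  There \<open>F\<close> is real analytic, hence constant on the whole line.  As \<open>t \<rightarrow> \<infinity>\<close> along the
  line, the terms of order \<open>t\<^sup>p\<close> and \<open>t\<^bsup>p-1\<^esup>\<close> cancel by the two relations on \<open>a\<close>, and because
  \<open>p \<noteq> 2\<close> the coefficient of \<open>t\<^bsup>p-2\<^esup>\<close> must vanish: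
  \<open>\<Sum> a\<^sub>z |z|\<^sup>2 + (p - 2) \<Sum> a\<^sub>z (z \<bullet> v)\<^sup>2 = 0\<close>.  Summing over an orthonormal basis gives
  \<open>\<Sum> a\<^sub>z (z \<bullet> v)\<^sup>2 = 0\<close> for all \<open>v\<close>, which is impossible for a circuit
  (\<open>circuit_quadratic_form_nonzero\<close>).  In dimension one, where \<open>F\<close> is not smooth at \<open>D\<close> and may even be
  constant outside the convex hull of \<open>D\<close> (for \<open>p = 1\<close>), the circuit is chosen to have points on both
  sides of \<open>x\<close>, and counting critical points shows that the level sets are countable between the
  extreme points of \<open>D\<close>.

  Uniqueness: if \<open>\<pi>\<close> and \<open>\<pi>'\<close> are optimal, then so is \<open>(\<pi> + \<pi>')/2\<close>.  Almost every \<open>\<pi>\<^sub>x\<close> and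
  \<open>\<pi>'\<^sub>x\<close> are therefore carried by one common affinely independent set, on which the barycenter
  \<open>x\<close> determines the weights.
\<close>

section \<open>Circuits and second moments\<close>

text \<open>
  The component of \<open>z - e\<close> orthogonal to the direction space of \<open>affine hull E\<close> does it.
\<close>

lemma affine_function_separating_point:
  fixes z :: "'a::euclidean_space"
  assumes "z \<notin> affine hull E" "e \<in> E"
  obtains l where "\<And>x. x \<in> E \<Longrightarrow> l \<bullet> (x - e) = 0" "l \<bullet> (z - e) \<noteq> 0"
proof -
  define V where "V = span ((\<lambda>x. - e + x) ` (E - {e}))"
  have aff: "affine hull E = (\<lambda>x. e + x) ` V"
    unfolding V_def using affine_hull_span2[OF assms(2)] by simp
  have nz: "z - e \<notin> V"
    using assms(1) unfolding aff by force
  obtain y l where y: "y \<in> V" and l: "\<And>w. w \<in> V \<Longrightarrow> orthogonal l w" and zy: "z - e = y + l"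
    using orthogonal_subspace_decomp_exists[of "(\<lambda>x. - e + x) ` (E - {e})" "z - e"]
    unfolding V_def by metis
  show thesis
  proof
    fix x assume "x \<in> E"
    then have "x - e \<in> V"
      unfolding V_def by (cases "x = e") (auto intro!: span_base span_zero imageI)
    then show "l \<bullet> (x - e) = 0" using l by (simp add: orthogonal_def)
  next
    have "l \<noteq> 0" using nz zy y by auto
    have "l \<bullet> (z - e) = l \<bullet> l" unfolding zy using l[OF y] by (simp add: orthogonal_def inner_add_right)
    then show "l \<bullet> (z - e) \<noteq> 0" using \<open>l \<noteq> 0\<close> by simp
  qed
qed

text \<open>
  The relations on \<open>a\<close> turn a vanishing quadratic form into \<open>\<Sum> a\<^sub>z f(z)\<^sup>2 = 0\<close> for all affine
  functions \<open>f\<close>.  Three nonzero reals include two of the same sign, say at \<open>y\<close> and \<open>z\<close>; as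
  \<open>D - {y}\<close> is independent, some affine \<open>f\<close> vanishes on \<open>D - {y, z}\<close> and not at \<open>z\<close>, and the
  two surviving terms cannot cancel.
\<close>

lemma circuit_quadratic_form_nonzero:
  fixes D :: "'a::euclidean_space set" and a :: "'a \<Rightarrow> real"
  assumes fin: "finite D" and card: "card D \<ge> 3"
    and ind: "\<And>z. z \<in> D \<Longrightarrow> \<not> affine_dependent (D - {z})"
    and nz: "\<And>z. z \<in> D \<Longrightarrow> a z \<noteq> 0"
    and a0: "(\<Sum>z\<in>D. a z) = 0" and a1: "(\<Sum>z\<in>D. a z *\<^sub>R z) = 0"
  shows "\<exists>l. (\<Sum>z\<in>D. a z * (z \<bullet> l)\<^sup>2) \<noteq> 0"
proof (rule ccontr)
  assume "\<not> ?thesis"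
  then have Q: "(\<Sum>z\<in>D. a z * (z \<bullet> l)\<^sup>2) = 0" for l by auto
  obtain T where T: "T \<subseteq> D" "card T = 3" using card obtain_subset_with_card_n by metis
  then obtain u v w where uvw: "T = {u,v,w}" "u \<noteq> v" "v \<noteq> w" "u \<noteq> w"
    using card_3_iff by metis
  then have "u \<in> D" "v \<in> D" "w \<in> D" using T by auto
  with nz have "a u \<noteq> 0" "a v \<noteq> 0" "a w \<noteq> 0" by auto
  then have "a u * a v > 0 \<or> a u * a w > 0 \<or> a v * a w > 0"
    by (auto simp: zero_less_mult_iff)
  then obtain y z where yz: "y \<in> T" "z \<in> T" "y \<noteq> z" "a y * a z > 0"
    using uvw by blast
  then have yD: "y \<in> D" and zD: "z \<in> D" using T by auto
  define E where "E = D - {y} - {z}"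
  have "\<exists>e. e \<in> T - {y,z}" using uvw yz by auto
  then obtain e where e: "e \<in> E" using T unfolding E_def by auto
  have "z \<notin> affine hull E"
    using ind[OF yD] zD yz(3) unfolding affine_dependent_def E_def by auto
  then obtain l where l0: "\<And>x. x \<in> E \<Longrightarrow> l \<bullet> (x - e) = 0" and lz: "l \<bullet> (z - e) \<noteq> 0"
    using affine_function_separating_point e by metis
  have lin: "(\<Sum>x\<in>D. a x * (x \<bullet> l)) = 0"
  proof -
    have "(\<Sum>x\<in>D. a x * (x \<bullet> l)) = (\<Sum>x\<in>D. a x *\<^sub>R x) \<bullet> l" by (simp add: inner_sum_left)
    then show ?thesis using a1 by simp
  qed
  have "(\<Sum>x\<in>D. a x * (l \<bullet> (x - e))\<^sup>2) =
    (\<Sum>x\<in>D. a x * (x \<bullet> l)\<^sup>2 - 2 * (l \<bullet> e) * (a x * (x \<bullet> l)) + (l \<bullet> e)\<^sup>2 * a x)"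
    by (intro sum.cong refl) (simp add: inner_diff_right inner_commute power2_diff algebra_simps)
  also have "\<dots> = (\<Sum>x\<in>D. a x * (x \<bullet> l)\<^sup>2) - 2 * (l \<bullet> e) * (\<Sum>x\<in>D. a x * (x \<bullet> l)) + (l \<bullet> e)\<^sup>2 * (\<Sum>x\<in>D. a x)"
    by (simp add: sum.distrib sum_subtractf sum_distrib_left)
  also have "\<dots> = 0" using Q lin a0 by simp
  finally have s0: "(\<Sum>x\<in>D. a x * (l \<bullet> (x - e))\<^sup>2) = 0" .
  have "(\<Sum>x\<in>D. a x * (l \<bullet> (x - e))\<^sup>2) = (\<Sum>x\<in>{y,z}. a x * (l \<bullet> (x - e))\<^sup>2)"
    using fin yD zD l0 by (intro sum.mono_neutral_right) (auto simp: E_def)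
  also have "\<dots> = a y * (l \<bullet> (y - e))\<^sup>2 + a z * (l \<bullet> (z - e))\<^sup>2" using yz by simp
  finally have "a y * (l \<bullet> (y - e))\<^sup>2 + a z * (l \<bullet> (z - e))\<^sup>2 = 0" using s0 by simp
  then have "a z * (a y * (l \<bullet> (y - e))\<^sup>2 + a z * (l \<bullet> (z - e))\<^sup>2) = 0" by simp
  then have "(a y * a z) * (l \<bullet> (y - e))\<^sup>2 + (a z * (l \<bullet> (z - e)))\<^sup>2 = 0"
    by (simp add: algebra_simps power2_eq_square)
  moreover have "(a y * a z) * (l \<bullet> (y - e))\<^sup>2 \<ge> 0" using yz by simp
  moreover have "(a z * (l \<bullet> (z - e)))\<^sup>2 > 0" using lz nz zD by simp
  ultimately show False by linarith
qed

section \<open>Level sets of radial sums\<close>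

text \<open>
  Tonelli and translation invariance: averaging the length of the slice over all base points \<open>x\<close>
  returns the measure of \<open>Z\<close>.
\<close>

lemma positive_measure_slice:
  fixes Z :: "'a::euclidean_space set"
  assumes Z[measurable]: "Z \<in> sets borel" and pos: "emeasure lborel Z > 0"
  shows "\<exists>x. emeasure lborel {t::real. 0 \<le> t \<and> t \<le> 1 \<and> x + t *\<^sub>R v \<in> Z} > 0"
proof (rule ccontr)
  assume "\<not> ?thesis"
  then have z: "emeasure lborel {t::real. 0 \<le> t \<and> t \<le> 1 \<and> x + t *\<^sub>R v \<in> Z} = 0" for x
    by (metis not_gr_zero)
  have m[measurable]: "(\<lambda>(x, t). indicator Z (x + t *\<^sub>R v) * indicator {0..1} t :: ennreal) \<in> borel_measurable (lborel \<Otimes>\<^sub>M lborel)"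
    by measurable
  have sl: "(\<integral>\<^sup>+t. indicator Z (x + t *\<^sub>R v) * indicator {0..1::real} t \<partial>lborel) = 0" for x
  proof -
    have "(\<integral>\<^sup>+t. indicator Z (x + t *\<^sub>R v) * indicator {0..1::real} t \<partial>lborel)
      = (\<integral>\<^sup>+t. indicator {t::real. 0 \<le> t \<and> t \<le> 1 \<and> x + t *\<^sub>R v \<in> Z} t \<partial>lborel)"
      by (intro nn_integral_cong) (auto simp: indicator_def)
    also have "\<dots> = emeasure lborel {t::real. 0 \<le> t \<and> t \<le> 1 \<and> x + t *\<^sub>R v \<in> Z}"
      by (intro nn_integral_indicator) measurable
    finally show ?thesis using z by simp
  qed
  have "(\<integral>\<^sup>+t. (\<integral>\<^sup>+x. indicator Z (x + t *\<^sub>R v) * indicator {0..1::real} t \<partial>lborel) \<partial>lborel) =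
    (\<integral>\<^sup>+x. (\<integral>\<^sup>+t. indicator Z (x + t *\<^sub>R v) * indicator {0..1::real} t \<partial>lborel) \<partial>lborel)"
    using lborel_pair.Fubini'[OF m] by simp
  also have "\<dots> = 0" using sl by simp
  finally have 0: "(\<integral>\<^sup>+t. (\<integral>\<^sup>+x. indicator Z (x + t *\<^sub>R v) * indicator {0..1::real} t \<partial>lborel) \<partial>lborel) = 0" .
  have tr: "(\<integral>\<^sup>+x. indicator Z (x + w) \<partial>lborel) = emeasure lborel Z" for w :: 'a
  proof -
    have "emeasure lborel Z = (\<integral>\<^sup>+x. indicator Z x \<partial>distr lborel borel (\<lambda>x. w + x))"
      by (subst lborel_distr_plus) simp
    also have "\<dots> = (\<integral>\<^sup>+x. indicator Z (w + x) \<partial>lborel)"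
      by (subst nn_integral_distr) auto
    finally show ?thesis by (simp add: add.commute)
  qed
  have "(\<integral>\<^sup>+t. (\<integral>\<^sup>+x. indicator Z (x + t *\<^sub>R v) * indicator {0..1::real} t \<partial>lborel) \<partial>lborel)
    = (\<integral>\<^sup>+t. emeasure lborel Z * indicator {0..1::real} t \<partial>lborel)"
    by (subst nn_integral_multc) (auto simp: tr)
  also have "\<dots> = emeasure lborel Z" by (subst nn_integral_cmult_indicator) auto
  finally show False using 0 pos by simp
qed

text \<open>
  The summands are squared distances, raised to a power, from a point moving on a line to centers off
  that line.  Such a function extends holomorphically to a strip around the real axis, where the
  identity theorem applies.
\<close>

lemma radial_sum_const_on_line:
  fixes a b e :: "'i \<Rightarrow> real" and T :: "real set"
  assumes fin: "finite D" and e: "\<And>z. z \<in> D \<Longrightarrow> e z > 0"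
    and T: "infinite T" "bounded T"
    and C: "\<And>t. t \<in> T \<Longrightarrow> (\<Sum>z\<in>D. a z * ((t + b z)\<^sup>2 + e z) powr r) = C"
  shows "(\<Sum>z\<in>D. a z * ((t + b z)\<^sup>2 + e z) powr r) = C"
proof -
  \<comment> \<open>For \<open>|Im w| < sqrt e\<close> the quadratic \<open>(w + b)\<^sup>2 + e\<close> avoids the branch cut of the power.\<close>
  define m where "m = Min (insert 1 ((\<lambda>z. sqrt (e z)) ` D))"
  have m0: "m > 0" unfolding m_def using fin e by (subst Min_gr_iff) auto
  have me: "m \<le> sqrt (e z)" if "z \<in> D" for z unfolding m_def using fin that by (intro Min_le) auto
  define S where "S = {w::complex. \<bar>Im w\<bar> < m}"
  have Seq: "S = {w. Im w < m} \<inter> {w. Im w > -m}" unfolding S_def by auto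
  have "open S" unfolding Seq by (intro open_Int open_halfspace_Im_lt open_halfspace_Im_gt)
  have "connected S" unfolding Seq
    by (intro convex_connected convex_Int convex_halfspace_Im_lt convex_halfspace_Im_gt)
  define f where "f w = (\<Sum>z\<in>D. of_real (a z) * ((w + of_real (b z))\<^sup>2 + of_real (e z)) powr of_real r) - of_real C" for w :: complex
  have fr: "f (of_real s) = of_real ((\<Sum>z\<in>D. a z * ((s + b z)\<^sup>2 + e z) powr r) - C)" for s
  proof -
    have "((of_real s + of_real (b z))\<^sup>2 + of_real (e z)) powr of_real r = (of_real (((s + b z)\<^sup>2 + e z) powr r) :: complex)"
      if "z \<in> D" for z
    proof -
      have "(of_real s + of_real (b z))\<^sup>2 + of_real (e z) = (of_real ((s + b z)\<^sup>2 + e z) :: complex)" by simp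
      moreover have "(s + b z)\<^sup>2 + e z \<ge> 0" using e[OF that] by (simp add: add_nonneg_nonneg less_imp_le)
      ultimately show ?thesis by (metis powr_of_real)
    qed
    then show ?thesis unfolding f_def by simp
  qed
  have nonpos: "(w + of_real (b z))\<^sup>2 + of_real (e z) \<notin> \<real>\<^sub>\<le>\<^sub>0" if w: "w \<in> S" and z: "z \<in> D" for w z
  proof
    assume as: "(w + of_real (b z))\<^sup>2 + of_real (e z) \<in> \<real>\<^sub>\<le>\<^sub>0"
    define x where "x = Re w + b z" define y where "y = Im w"
    have re: "x\<^sup>2 - y\<^sup>2 + e z \<le> 0" and im: "2 * x * y = 0"
      using as unfolding complex_nonpos_Reals_iff x_def y_def by (auto simp: power2_eq_square)
    have "\<bar>y\<bar> < sqrt (e z)" using w me[OF z] unfolding S_def y_def by simp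
    then have y2: "y\<^sup>2 < e z" using e[OF z] by (simp add: real_less_rsqrt abs_less_iff) (metis abs_less_iff real_sqrt_abs real_sqrt_less_iff)
    have "x\<^sup>2 \<ge> 0" by simp
    then show False using re y2 by linarith
  qed
  have hol: "f holomorphic_on S"
    unfolding f_def by (intro holomorphic_intros) (use nonpos in auto)
  obtain \<tau> where tau: "\<tau> islimpt T"
    using T bounded_infinite_imp_islimpt by (metis order_refl)
  have lim: "complex_of_real \<tau> islimpt (of_real ` T)"
    unfolding islimpt_approachable
  proof (intro allI impI)
    fix ep :: real assume "ep > 0"
    then obtain x' where "x' \<in> T" "x' \<noteq> \<tau>" "dist x' \<tau> < ep" using tau unfolding islimpt_approachable by metis
    then show "\<exists>x'\<in>complex_of_real ` T. x' \<noteq> complex_of_real \<tau> \<and> dist x' (complex_of_real \<tau>) < ep"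
      by (intro bexI[of _ "of_real x'"]) auto
  qed
  have "f (of_real t) = 0"
    by (rule analytic_continuation[OF hol \<open>open S\<close> \<open>connected S\<close> _ _ lim])
       (use m0 C in \<open>auto simp: S_def fr\<close>)
  then show ?thesis unfolding fr of_real_eq_0_iff by simp
qed

lemma powr_quadratic_expansion:
  fixes b c r :: real
  shows "((\<lambda>t. t\<^sup>2 * ((1 + 2 * b / t + c / t\<^sup>2) powr r - 1 - 2 * r * b / t)) \<longlongrightarrow> r * (c + 2 * (r - 1) * b\<^sup>2)) at_top"
proof -
  have eq: "r * (c + 2 * (r - 1) * b\<^sup>2) = 2 * b * (b * ((r - 1) * r)) + c * r"
    by (simp add: algebra_simps power2_eq_square)
  show ?thesis unfolding eq by real_asymp
qed

text \<open>
  Expansion at infinity.  After the two cancellations the sum equals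
  \<open>t\<^bsup>p-2\<^esup> (K + o(1))\<close>, where \<open>K\<close> is \<open>p/2\<close> times the sum to be shown zero.  For \<open>p > 2\<close> a nonzero
  \<open>K\<close> would make the sum unbounded; for \<open>p < 2\<close> the sum tends to 0, so the constant \<open>C\<close> is 0 and again
  \<open>K = 0\<close>.
\<close>

lemma radial_sum_second_moment:
  fixes a b c :: "'i \<Rightarrow> real"
  assumes fin: "finite D" and a0: "(\<Sum>z\<in>D. a z) = 0" and ab: "(\<Sum>z\<in>D. a z * b z) = 0"
    and p: "p > 0" "p \<noteq> 2"
    and C: "\<And>t. (\<Sum>z\<in>D. a z * (t\<^sup>2 + 2 * t * b z + c z) powr (p / 2)) = C"
    and nn: "\<And>z t. z \<in> D \<Longrightarrow> t\<^sup>2 + 2 * t * b z + c z \<ge> 0"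
  shows "(\<Sum>z\<in>D. a z * (c z + (p - 2) * (b z)\<^sup>2)) = 0"
proof -
  define K where "K = (\<Sum>z\<in>D. a z * (p / 2 * (c z + 2 * (p / 2 - 1) * (b z)\<^sup>2)))"
  have lim0: "((\<lambda>t. \<Sum>z\<in>D. a z * (t\<^sup>2 * ((1 + 2 * b z / t + c z / t\<^sup>2) powr (p / 2) - 1 - 2 * (p / 2) * b z / t)))
      \<longlongrightarrow> K) at_top"
    unfolding K_def by (intro tendsto_sum tendsto_mult_left powr_quadratic_expansion)
  have ev: "(\<Sum>z\<in>D. a z * (t\<^sup>2 * ((1 + 2 * b z / t + c z / t\<^sup>2) powr (p / 2) - 1 - 2 * (p / 2) * b z / t)))
      = C * t powr (2 - p)" if t: "t > 0" for t
  proof -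
    have pw: "t\<^sup>2 * (1 + 2 * b z / t + c z / t\<^sup>2) powr (p / 2) = t powr (2 - p) * (t\<^sup>2 + 2 * t * b z + c z) powr (p / 2)"
      if z: "z \<in> D" for z
    proof -
      have f: "t\<^sup>2 * (1 + 2 * b z / t + c z / t\<^sup>2) = t\<^sup>2 + 2 * t * b z + c z"
        using t by (simp add: field_simps power2_eq_square)
      have g: "1 + 2 * b z / t + c z / t\<^sup>2 \<ge> 0"
        using nn[OF z, of t] t unfolding f[symmetric] by (simp add: zero_le_mult_iff)
      have "(t\<^sup>2 + 2 * t * b z + c z) powr (p / 2) = (t\<^sup>2) powr (p / 2) * (1 + 2 * b z / t + c z / t\<^sup>2) powr (p / 2)"
        unfolding f[symmetric] using g by (subst powr_mult) auto
      also have "(t\<^sup>2) powr (p / 2) = t powr p"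
        using t by (simp add: powr_powr flip: powr_numeral)
      finally have "t powr (2 - p) * (t\<^sup>2 + 2 * t * b z + c z) powr (p / 2) =
        (t powr (2 - p) * t powr p) * (1 + 2 * b z / t + c z / t\<^sup>2) powr (p / 2)" by simp
      also have "t powr (2 - p) * t powr p = t\<^sup>2"
        using t by (simp flip: powr_add powr_numeral)
      finally show ?thesis by simp
    qed
    have "(\<Sum>z\<in>D. a z * (t\<^sup>2 * ((1 + 2 * b z / t + c z / t\<^sup>2) powr (p / 2) - 1 - 2 * (p / 2) * b z / t)))
      = (\<Sum>z\<in>D. t powr (2 - p) * (a z * (t\<^sup>2 + 2 * t * b z + c z) powr (p / 2)) - t\<^sup>2 * a z - (t * p) * (a z * b z))"
    proof (intro sum.cong refl)
      fix z assume "z \<in> D"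
      have "t\<^sup>2 * (2 * (p / 2) * b z / t) = t * p * b z" using t by (simp add: power2_eq_square)
      then show "a z * (t\<^sup>2 * ((1 + 2 * b z / t + c z / t\<^sup>2) powr (p / 2) - 1 - 2 * (p / 2) * b z / t)) =
        t powr (2 - p) * (a z * (t\<^sup>2 + 2 * t * b z + c z) powr (p / 2)) - t\<^sup>2 * a z - (t * p) * (a z * b z)"
        using pw[OF \<open>z \<in> D\<close>] unfolding right_diff_distrib by (simp add: mult_ac)
    qed
    also have "\<dots> = t powr (2 - p) * (\<Sum>z\<in>D. a z * (t\<^sup>2 + 2 * t * b z + c z) powr (p / 2))
        - t\<^sup>2 * (\<Sum>z\<in>D. a z) - (t * p) * (\<Sum>z\<in>D. a z * b z)"
      by (simp add: sum_subtractf sum_distrib_left)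
    also have "\<dots> = C * t powr (2 - p)" unfolding C a0 ab by simp
    finally show ?thesis .
  qed
  have lim: "((\<lambda>t. C * t powr (2 - p)) \<longlongrightarrow> K) at_top"
    by (rule Lim_transform_eventually[OF lim0 eventually_mono[OF eventually_gt_at_top[of 0] ev]])
  have "K = 0"
  proof (cases "p > 2")
    case True
    then have "((\<lambda>t. C * t powr (2 - p)) \<longlongrightarrow> 0) at_top" by real_asymp
    then show ?thesis using lim tendsto_unique trivial_limit_at_top_linorder by metis
  next
    case False
    then have "p < 2" using p by simp
    then have "((\<lambda>t::real. t powr (p - 2)) \<longlongrightarrow> 0) at_top" by real_asymp
    from tendsto_mult[OF lim this] have "((\<lambda>t. C * t powr (2 - p) * t powr (p - 2)) \<longlongrightarrow> 0) at_top" by simp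
    moreover have "eventually (\<lambda>t. C * t powr (2 - p) * t powr (p - 2) = C) at_top"
      by (intro eventually_mono[OF eventually_gt_at_top[of 0]]) (simp add: mult.assoc flip: powr_add)
    ultimately have "((\<lambda>t::real. C) \<longlongrightarrow> 0) at_top"
      by (rule Lim_transform_eventually)
    then have "C = 0" by (simp add: tendsto_const_iff)
    with lim show ?thesis by (simp add: tendsto_const_iff)
  qed
  moreover have "K = p / 2 * (\<Sum>z\<in>D. a z * (c z + (p - 2) * (b z)\<^sup>2))"
    unfolding K_def sum_distrib_left by (intro sum.cong refl) (simp add: algebra_simps)
  ultimately show ?thesis using p by simp
qed

lemma null_line:
  fixes z v :: "'a::euclidean_space"
  assumes "DIM('a) \<ge> 2"
  shows "(\<lambda>w. z + w) ` span {v} \<in> null_sets lborel"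
proof -
  have "dim (span {v}) < DIM('a)"
    using assms dim_le_card[of "{v}" "{v}"] by (auto simp: span_superset)
  then have n: "negligible ((\<lambda>w. z + w) ` span {v})"
    by (intro negligible_translation negligible_lowdim)
  have "closed ((\<lambda>w. z + w) ` span {v})"
    by (intro closed_translation closed_span)
  then have "(\<lambda>w. z + w) ` span {v} \<in> sets lborel" by simp
  with n show ?thesis unfolding negligible_iff_null_sets null_sets_completion_iff[OF \<open>_ \<in> sets lborel\<close>] by simp
qed

text \<open>
  A level set of positive measure contains infinitely many points of a bounded segment in every direction
  \<open>v\<close>, on lines off \<open>D\<close>; the expansion at infinity along them gives one quadratic relation per direction
  (\<open>key\<close> below), and all of these together contradict \<open>circuit_quadratic_form_nonzero\<close>.
\<close>

lemma radial_sum_level_set_null: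
  fixes D :: "'a::euclidean_space set" and a :: "'a \<Rightarrow> real"
  assumes d: "DIM('a) \<ge> 2"
    and fin: "finite D" and card: "card D \<ge> 3"
    and ind: "\<And>z. z \<in> D \<Longrightarrow> \<not> affine_dependent (D - {z})"
    and nz: "\<And>z. z \<in> D \<Longrightarrow> a z \<noteq> 0"
    and a0: "(\<Sum>z\<in>D. a z) = 0" and a1: "(\<Sum>z\<in>D. a z *\<^sub>R z) = 0"
    and p: "p > 0" "p \<noteq> 2"
  shows "{x. (\<Sum>z\<in>D. a z * norm (x - z) powr p) = C} \<in> null_sets lborel"
proof (rule ccontr)
  define Z where "Z = {x. (\<Sum>z\<in>D. a z * norm (x - z) powr p) = C}"
  have Zm[measurable]: "Z \<in> sets borel" unfolding Z_def by measurable
  assume "\<not> ?thesis"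
  then have Zpos: "emeasure lborel Z \<noteq> 0" using Zm unfolding Z_def by auto
  have lin: "(\<Sum>z\<in>D. a z * (z \<bullet> l)) = 0" for l
  proof -
    have "(\<Sum>z\<in>D. a z * (z \<bullet> l)) = (\<Sum>x\<in>D. a x *\<^sub>R x) \<bullet> l" by (simp add: inner_sum_left)
    then show ?thesis using a1 by simp
  qed
  define M where "M = (\<Sum>z\<in>D. a z * (norm z)\<^sup>2)"
  define q where "q v = (\<Sum>z\<in>D. a z * (z \<bullet> v)\<^sup>2)" for v
  have key: "M + (p - 2) * q v = 0" if v: "norm v = 1" for v
  proof -
    define L where "L = (\<Union>z\<in>D. (\<lambda>w. z + w) ` span {v})"
    have Ln: "L \<in> null_sets lborel"
      unfolding L_def using fin null_line[OF d] by (intro null_sets_UN') (auto intro: countable_finite)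
    then have [measurable]: "L \<in> sets borel" by auto
    have "emeasure lborel (Z - L) = emeasure lborel Z"
      using Ln Zm by (intro emeasure_Diff_null_set) auto
    then have "emeasure lborel (Z - L) > 0" using Zpos by (simp add: zero_less_iff_neq_zero)
    then obtain x where x: "emeasure lborel {t::real. 0 \<le> t \<and> t \<le> 1 \<and> x + t *\<^sub>R v \<in> Z - L} > 0"
      using positive_measure_slice[of "Z - L" v] by auto
    define T where "T = {t::real. 0 \<le> t \<and> t \<le> 1 \<and> x + t *\<^sub>R v \<in> Z - L}"
    have Tinf: "infinite T"
      using x null_setsD1[OF finite_imp_null_set_lborel[of T]] unfolding T_def[symmetric] by auto
    have Tb: "bounded T" unfolding T_def by (rule bounded_subset[of "{0..1}"]) auto
    obtain t0 where t0: "t0 \<in> T" using Tinf by (metis finite.emptyI ex_in_conv)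
    define b where "b z = (x - z) \<bullet> v" for z
    define c where "c z = (norm (x - z))\<^sup>2" for z
    have nrm: "(norm (x + t *\<^sub>R v - z))\<^sup>2 = t\<^sup>2 + 2 * t * b z + c z" for t z
    proof -
      have vv: "v \<bullet> v = 1" using v by (simp add: norm_eq_1)
      have "(norm ((x - z) + t *\<^sub>R v))\<^sup>2 = t\<^sup>2 * (v \<bullet> v) + 2 * t * ((x - z) \<bullet> v) + (x - z) \<bullet> (x - z)"
        unfolding power2_norm_eq_inner
        by (simp add: inner_add_left inner_add_right inner_commute power2_eq_square)
      moreover have "x + t *\<^sub>R v - z = (x - z) + t *\<^sub>R v" by simp
      ultimately show ?thesis unfolding b_def c_def power2_norm_eq_inner vv by (simp only: mult_1_right)
    qed
    have powr2: "norm y powr p = ((norm y)\<^sup>2) powr (p / 2)" for y :: 'a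
      by (cases "y = 0") (use p in \<open>auto simp: powr_powr simp flip: powr_numeral\<close>)
    have sq: "t\<^sup>2 + 2 * t * b z + c z = (t + b z)\<^sup>2 + (c z - (b z)\<^sup>2)" for t z
      by (simp add: power2_sum)
    have e: "c z - (b z)\<^sup>2 > 0" if z: "z \<in> D" for z
    proof -
      have "c z - (b z)\<^sup>2 = (norm (x + (- b z) *\<^sub>R v - z))\<^sup>2"
        unfolding nrm sq by simp
      moreover have "x + (- b z) *\<^sub>R v - z \<noteq> 0"
      proof
        assume "x + (- b z) *\<^sub>R v - z = 0"
        then have "x + t0 *\<^sub>R v = z + (b z + t0) *\<^sub>R v"
          by (simp add: algebra_simps)
        moreover have "(b z + t0) *\<^sub>R v \<in> span {v}" by (intro span_mul span_base) simp
        ultimately have "x + t0 *\<^sub>R v \<in> L" unfolding L_def using z by auto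
        then show False using t0 unfolding T_def by auto
      qed
      ultimately show ?thesis by simp
    qed
    have all: "(\<Sum>z\<in>D. a z * ((t + b z)\<^sup>2 + (c z - (b z)\<^sup>2)) powr (p / 2)) = C" for t
    proof (rule radial_sum_const_on_line[OF fin e Tinf Tb])
      fix t assume "t \<in> T"
      then have "x + t *\<^sub>R v \<in> Z" unfolding T_def by auto
      then show "(\<Sum>z\<in>D. a z * ((t + b z)\<^sup>2 + (c z - (b z)\<^sup>2)) powr (p / 2)) = C"
        unfolding Z_def sq[symmetric] nrm[symmetric] powr2[symmetric] by simp
    qed
    have ab: "(\<Sum>z\<in>D. a z * b z) = 0"
    proof -
      have "(\<Sum>z\<in>D. a z * b z) = (\<Sum>z\<in>D. (x \<bullet> v) * a z - a z * (z \<bullet> v))"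
        unfolding b_def by (intro sum.cong refl) (simp add: inner_diff_left algebra_simps)
      also have "\<dots> = (x \<bullet> v) * (\<Sum>z\<in>D. a z) - (\<Sum>z\<in>D. a z * (z \<bullet> v))"
        by (simp add: sum_subtractf sum_distrib_left)
      finally show ?thesis using a0 lin by simp
    qed
    have "(\<Sum>z\<in>D. a z * (c z + (p - 2) * (b z)\<^sup>2)) = 0"
    proof (rule radial_sum_second_moment[OF fin a0 ab p])
      show "(\<Sum>z\<in>D. a z * (t\<^sup>2 + 2 * t * b z + c z) powr (p / 2)) = C" for t
        unfolding sq by (rule all)
      show "t\<^sup>2 + 2 * t * b z + c z \<ge> 0" for z t
        unfolding nrm[symmetric] by simp
    qed
    moreover have "(\<Sum>z\<in>D. a z * c z) = M"
    proof -
      have "(\<Sum>z\<in>D. a z * c z) = (\<Sum>z\<in>D. (norm x)\<^sup>2 * a z - 2 * (a z * (z \<bullet> x)) + a z * (norm z)\<^sup>2)"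
        unfolding c_def power2_norm_eq_inner
        by (intro sum.cong refl) (simp add: inner_diff_left inner_diff_right inner_commute algebra_simps)
      also have "\<dots> = (norm x)\<^sup>2 * (\<Sum>z\<in>D. a z) - 2 * (\<Sum>z\<in>D. a z * (z \<bullet> x)) + M"
        unfolding M_def by (simp add: sum.distrib sum_subtractf sum_distrib_left)
      finally show ?thesis using a0 lin by simp
    qed
    moreover have "(\<Sum>z\<in>D. a z * (b z)\<^sup>2) = q v"
    proof -
      have "(\<Sum>z\<in>D. a z * (b z)\<^sup>2) = (\<Sum>z\<in>D. (x \<bullet> v)\<^sup>2 * a z - 2 * (x \<bullet> v) * (a z * (z \<bullet> v)) + a z * (z \<bullet> v)\<^sup>2)"
        unfolding b_def
        by (intro sum.cong refl) (simp add: inner_diff_left power2_diff algebra_simps)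
      also have "\<dots> = (x \<bullet> v)\<^sup>2 * (\<Sum>z\<in>D. a z) - 2 * (x \<bullet> v) * (\<Sum>z\<in>D. a z * (z \<bullet> v)) + q v"
        unfolding q_def by (simp add: sum.distrib sum_subtractf sum_distrib_left)
      finally show ?thesis using a0 lin by simp
    qed
    ultimately show ?thesis
      by (simp add: distrib_left sum.distrib sum_distrib_left[symmetric] mult.left_commute[of _ "p - 2"])
  qed
  \<comment> \<open>Averaging the relation over an orthonormal basis separates \<open>M\<close> from \<open>q\<close>: the resulting factor
    \<open>d + p - 2\<close> is positive since \<open>d \<ge> 2\<close> and \<open>p > 0\<close>.\<close>
  have "(\<Sum>b\<in>(Basis::'a set). q b) = M"
  proof -
    have "(\<Sum>b\<in>(Basis::'a set). q b) = (\<Sum>z\<in>D. a z * (\<Sum>b\<in>Basis. (z \<bullet> b)\<^sup>2))"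
      unfolding q_def sum_distrib_left by (rule sum.swap)
    also have "\<dots> = M" unfolding M_def power2_norm_eq_inner
      by (intro sum.cong refl) (simp add: power2_eq_square euclidean_inner[symmetric])
    finally show ?thesis .
  qed
  moreover have "(\<Sum>b\<in>(Basis::'a set). M + (p - 2) * q b) = 0"
    using key by (intro sum.neutral) auto
  ultimately have "real DIM('a) * M + (p - 2) * M = 0"
    by (simp only: sum.distrib sum_distrib_left[symmetric] sum_constant)
  then have "(real DIM('a) + p - 2) * M = 0"
    by (simp add: algebra_simps)
  moreover have "real DIM('a) + p - 2 > 0" using d p by linarith
  ultimately have M0: "M = 0" by simp
  have q1: "q v = 0" if "norm v = 1" for v using key[OF that] M0 p by simp
  have "q l = 0" for l
  proof (cases "l = 0")
    case False
    define v where "v = (1 / norm l) *\<^sub>R l"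
    have "norm v = 1" using False unfolding v_def by simp
    moreover have "l = norm l *\<^sub>R v" using False unfolding v_def by simp
    moreover have "q (r *\<^sub>R v) = r\<^sup>2 * q v" for r
      unfolding q_def sum_distrib_left by (intro sum.cong refl) (simp add: power_mult_distrib)
    ultimately show ?thesis using q1 by (metis mult_zero_right)
  qed (simp add: q_def)
  then show False
    using circuit_quadratic_form_nonzero[OF fin card ind nz a0 a1] unfolding q_def by simp
qed

text \<open>
  These points are isolated in the set, and a discrete subset of the line is countable.
\<close>

lemma countable_level_set_deriv_nonzero:
  fixes f f' :: "real \<Rightarrow> real"
  assumes der: "\<And>t. t \<in> I \<Longrightarrow> (f has_real_derivative f' t) (at t)"
  shows "countable {t \<in> I. f t = C \<and> f' t \<noteq> 0}"
proof -
  define X where "X = {t \<in> I. f t = C \<and> f' t \<noteq> 0}"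
  have "\<exists>U. open U \<and> U \<inter> X = {t}" if t: "t \<in> X" for t
  proof -
    have "((\<lambda>s. (f s - f t) / (s - t)) \<longlongrightarrow> f' t) (at t)"
      using der[of t] t unfolding X_def has_field_derivative_iff by auto
    then have "eventually (\<lambda>s. (f s - f t) / (s - t) \<noteq> 0) (at t)"
      using t unfolding X_def by (intro tendsto_imp_eventually_ne) auto
    then obtain U where "open U" "t \<in> U" "\<forall>s\<in>U. s \<noteq> t \<longrightarrow> (f s - f t) / (s - t) \<noteq> 0"
      unfolding eventually_at_topological by blast
    then show ?thesis using t by (intro exI[of _ U]) (auto simp: X_def)
  qed
  then obtain U where U: "\<And>t. t \<in> X \<Longrightarrow> open (U t) \<and> U t \<inter> X = {t}" by metis
  obtain F where F: "F \<subseteq> U ` X" "countable F" "\<Union>F = \<Union>(U ` X)"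
    using Lindelof[of "U ` X"] U by blast
  have inj: "inj_on U X" using U by (metis inj_onI singleton_inject)
  have "U ` X \<subseteq> F"
  proof
    fix W assume "W \<in> U ` X"
    then obtain t where t: "t \<in> X" "W = U t" by auto
    then have "t \<in> \<Union>F" using F(3) U by blast
    then obtain s where s: "s \<in> X" "t \<in> U s" "U s \<in> F" using F(1) by auto
    then have "t = s" using U[OF s(1)] t by blast
    then show "W \<in> F" using s t by simp
  qed
  then have "countable (U ` X)" using F(2) by (rule countable_subset)
  then have "countable X" using inj by (rule countable_image_inj_on)
  then show ?thesis unfolding X_def .
qed

lemma countable_level_set:
  fixes f f' :: "real \<Rightarrow> real"
  assumes der: "\<And>t. t \<in> I \<Longrightarrow> (f has_real_derivative f' t) (at t)"
    and crit: "countable {t \<in> I. f' t = 0}"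
  shows "countable {t \<in> I. f t = C}"
  by (rule countable_subset[OF _ countable_Un[OF countable_level_set_deriv_nonzero[OF der, of I C] crit]]) auto

text \<open>
  Rolle's argument, with countability in place of counting zeros.  The derivative is a combination of
  three powers with exponent \<open>p - 1\<close>; dividing by the first of them and differentiating again leaves two
  powers with exponent \<open>p - 2 \<noteq> 0\<close>, which balance in at most one point.  The sign \<open>s\<close> tells on which
  side of the middle center \<open>y1\<close> the set \<open>I\<close> lies.
\<close>

lemma countable_level_set_three_powers:
  fixes y0 y1 y2 s :: real
  assumes I: "\<And>t. t \<in> I \<Longrightarrow> y0 < t \<and> t < y2 \<and> s * (t - y1) > 0" and s: "s = 1 \<or> s = -1"
    and y: "y0 < y1" "y1 < y2"
    and nz: "a0 \<noteq> 0" "a1 \<noteq> 0" "a2 \<noteq> 0"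
    and A0: "a0 + a1 + a2 = 0" and A1: "a0 * y0 + a1 * y1 + a2 * y2 = 0"
    and p: "p > 0" "p \<noteq> 2"
  shows "countable {t \<in> I. a0 * (t - y0) powr p + a1 * (s * (t - y1)) powr p + a2 * (y2 - t) powr p = C}"
proof -
  define g where "g t = a0 * (t - y0) powr (p - 1) + a1 * s * (s * (t - y1)) powr (p - 1) - a2 * (y2 - t) powr (p - 1)" for t
  \<comment> \<open>Hence the two powers in \<open>G'\<close> below have opposite coefficients.\<close>
  have rel: "a1 * (y1 - y0) = - a2 * (y2 - y0)"
  proof -
    have "a1 * (y1 - y0) + a2 * (y2 - y0) = (a0 * y0 + a1 * y1 + a2 * y2) - y0 * (a0 + a1 + a2)" by (simp add: algebra_simps)
    then show ?thesis using A0 A1 by simp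
  qed
  have crit: "countable {t \<in> I. p * g t = 0}"
  proof (cases "p = 1")
    case True
    have "g t \<noteq> 0" if "t \<in> I" for t
      using I[OF that] s nz A0 unfolding g_def True by auto
    then have "{t \<in> I. p * g t = 0} = {}" using p by auto
    then show ?thesis by (simp only: countable_empty)
  next
    case p1: False
    define G where "G t = a0 + a1 * s * (s * (t - y1) / (t - y0)) powr (p - 1) - a2 * ((y2 - t) / (t - y0)) powr (p - 1)" for t
    define r1 where "r1 t = s * (t - y1) / (t - y0)" for t
    define r2 where "r2 t = (y2 - t) / (t - y0)" for t
    have gG: "g t = (t - y0) powr (p - 1) * G t" if t: "t \<in> I" for t
    proof -
      have *: "(t - y0) powr (p - 1) > 0" using I[OF t] by simp
      have "(s * (t - y1) / (t - y0)) powr (p - 1) = (s * (t - y1)) powr (p - 1) / (t - y0) powr (p - 1)"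
        "((y2 - t) / (t - y0)) powr (p - 1) = (y2 - t) powr (p - 1) / (t - y0) powr (p - 1)"
        using I[OF t] by (auto intro!: powr_divide)
      then show ?thesis unfolding g_def G_def using * by (simp add: field_simps)
    qed
    define G' where "G' t = (p - 1) * (a1 * (y1 - y0) * (r1 t powr (p - 2) - r2 t powr (p - 2))) / (t - y0)\<^sup>2" for t
    have r1d: "(r1 has_real_derivative s * (y1 - y0) / (t - y0)\<^sup>2) (at t)" if t: "t \<in> I" for t
      unfolding r1_def using I[OF t]
      by (auto intro!: derivative_eq_intros simp: field_simps power2_eq_square)
    have r2d: "(r2 has_real_derivative - (y2 - y0) / (t - y0)\<^sup>2) (at t)" if t: "t \<in> I" for t
      unfolding r2_def using I[OF t]
      by (auto intro!: derivative_eq_intros simp: field_simps power2_eq_square)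
    have rpos: "r1 t > 0" "r2 t > 0" if t: "t \<in> I" for t
      using I[OF t] unfolding r1_def r2_def by auto
    have Gd: "(G has_real_derivative G' t) (at t)" if t: "t \<in> I" for t
    proof -
      have ss: "s * s = 1" using s by auto
      have d1: "((\<lambda>t. r1 t powr (p - 1)) has_real_derivative (p - 1) * r1 t powr (p - 2) * (s * (y1 - y0) / (t - y0)\<^sup>2)) (at t)"
        using DERIV_fun_powr[OF r1d[OF t] rpos(1)[OF t], of "p - 1"] by simp
      have d2: "((\<lambda>t. r2 t powr (p - 1)) has_real_derivative (p - 1) * r2 t powr (p - 2) * (- (y2 - y0) / (t - y0)\<^sup>2)) (at t)"
        using DERIV_fun_powr[OF r2d[OF t] rpos(2)[OF t], of "p - 1"] by simp
      have "((\<lambda>t. a0 + a1 * s * r1 t powr (p - 1) - a2 * r2 t powr (p - 1)) has_real_derivative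
        (0 + a1 * s * ((p - 1) * r1 t powr (p - 2) * (s * (y1 - y0) / (t - y0)\<^sup>2))
         - a2 * ((p - 1) * r2 t powr (p - 2) * (- (y2 - y0) / (t - y0)\<^sup>2)))) (at t)"
        by (intro DERIV_diff DERIV_add DERIV_const DERIV_cmult d1 d2)
      also have "(0 + a1 * s * ((p - 1) * r1 t powr (p - 2) * (s * (y1 - y0) / (t - y0)\<^sup>2))
         - a2 * ((p - 1) * r2 t powr (p - 2) * (- (y2 - y0) / (t - y0)\<^sup>2)))
        = (p - 1) * ((s * s) * (a1 * (y1 - y0)) * r1 t powr (p - 2) - (- a2 * (y2 - y0)) * r2 t powr (p - 2)) / (t - y0)\<^sup>2"
        using I[OF t] by (simp add: field_simps)
      also have "\<dots> = G' t" unfolding G'_def ss rel[symmetric] by (simp add: algebra_simps)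
      finally show ?thesis unfolding G_def r1_def r2_def .
    qed
    have "{t \<in> I. G' t = 0} \<subseteq> {(y1 + y2) / 2}"
    proof
      fix t assume "t \<in> {t \<in> I. G' t = 0}"
      then have t: "t \<in> I" and "G' t = 0" by auto
      then have "r1 t powr (p - 2) = r2 t powr (p - 2)"
        using p1 nz y I[OF t] unfolding G'_def by auto
      then have "ln (r1 t powr (p - 2)) = ln (r2 t powr (p - 2))" by (rule arg_cong)
      then have "(p - 2) * ln (r1 t) = (p - 2) * ln (r2 t)" using rpos[OF t] by (simp only: ln_powr)
      then have "r1 t = r2 t" using rpos[OF t] p by simp
      then have "s * (t - y1) = y2 - t" unfolding r1_def r2_def using I[OF t] by simp
      then show "t \<in> {(y1 + y2) / 2}" using s y by auto
    qed
    then have "countable {t \<in> I. G' t = 0}" by (rule countable_subset) simp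
    then have "countable {t \<in> I. G t = 0}"
      by (rule countable_level_set[where f' = G', rotated]) (rule Gd)
    moreover have "{t \<in> I. p * g t = 0} \<subseteq> {t \<in> I. G t = 0}"
    proof
      fix t assume "t \<in> {t \<in> I. p * g t = 0}"
      then have t: "t \<in> I" "g t = 0" using p by auto
      then show "t \<in> {t \<in> I. G t = 0}" using gG[OF t(1)] I[OF t(1)] by simp
    qed
    ultimately show ?thesis by (rule countable_subset[rotated])
  qed
  have der: "((\<lambda>t. a0 * (t - y0) powr p + a1 * (s * (t - y1)) powr p + a2 * (y2 - t) powr p)
     has_real_derivative p * g t) (at t)" if t: "t \<in> I" for t
  proof -
    have d0: "((\<lambda>t. (t - y0) powr p) has_real_derivative p * (t - y0) powr (p - 1) * 1) (at t)"
      by (rule DERIV_fun_powr[of _ 1, simplified of_nat_1]) (use I[OF t] in \<open>auto intro!: derivative_eq_intros\<close>)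
    have d1: "((\<lambda>t. (s * (t - y1)) powr p) has_real_derivative p * (s * (t - y1)) powr (p - 1) * s) (at t)"
      by (rule DERIV_fun_powr[of _ s, simplified of_nat_1]) (use I[OF t] in \<open>auto intro!: derivative_eq_intros\<close>)
    have d2: "((\<lambda>t. (y2 - t) powr p) has_real_derivative p * (y2 - t) powr (p - 1) * (-1)) (at t)"
      by (rule DERIV_fun_powr[of _ "-1", simplified of_nat_1]) (use I[OF t] in \<open>auto intro!: derivative_eq_intros\<close>)
    have "((\<lambda>t. a0 * (t - y0) powr p + a1 * (s * (t - y1)) powr p + a2 * (y2 - t) powr p)
      has_real_derivative a0 * (p * (t - y0) powr (p - 1) * 1) + a1 * (p * (s * (t - y1)) powr (p - 1) * s)
        + a2 * (p * (y2 - t) powr (p - 1) * (-1))) (at t)"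
      by (intro DERIV_add DERIV_cmult d0 d1 d2)
    then show ?thesis unfolding g_def by (simp add: algebra_simps)
  qed
  show ?thesis by (rule countable_level_set[where f' = "\<lambda>t. p * g t", OF der crit])
qed

section \<open>Circuits and their level sets\<close>

text \<open>
  On the real line the centers lie on the line itself, so that analytic continuation across them fails;
  the level set is countable on each interval between neighbouring centers instead.  Outside the hull
  of \<open>D\<close> the claim is false for \<open>p = 1\<close>.
\<close>

lemma radial_sum_level_set_null_line:
  fixes D :: "'a::euclidean_space set" and a :: "'a \<Rightarrow> real"
  assumes d: "DIM('a) = 1" and b: "b \<in> Basis"
    and card: "card D = 3"
    and nz: "\<And>z. z \<in> D \<Longrightarrow> a z \<noteq> 0"
    and a0: "(\<Sum>z\<in>D. a z) = 0" and a1: "(\<Sum>z\<in>D. a z *\<^sub>R z) = 0"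
    and p: "p > 0" "p \<noteq> 2"
  shows "{x. (\<exists>u\<in>D. \<exists>w\<in>D. u \<bullet> b < x \<bullet> b \<and> x \<bullet> b < w \<bullet> b) \<and> (\<Sum>z\<in>D. a z * norm (x - z) powr p) = C} \<in> null_sets lborel"
proof -
  have B: "Basis = {b}" using d b by (metis card_1_singletonE singletonD)
  have rep: "x = (x \<bullet> b) *\<^sub>R b" for x :: 'a
    using euclidean_representation[of x] unfolding B by simp
  have inj: "x = y" if "x \<bullet> b = y \<bullet> b" for x y :: 'a
    using rep[of x] rep[of y] that by simp
  have nrm: "norm x = \<bar>x \<bullet> b\<bar>" for x :: 'a
    using rep[of x] b by (metis mult.right_neutral norm_Basis norm_scaleR)
  obtain z0 z1 z2 where D: "D = {z0, z1, z2}" and y: "z0 \<bullet> b < z1 \<bullet> b" "z1 \<bullet> b < z2 \<bullet> b"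
  proof -
    obtain u v w where uvw: "D = {u, v, w}" "u \<noteq> v" "v \<noteq> w" "u \<noteq> w"
      using card card_3_iff by metis
    then have "u \<bullet> b \<noteq> v \<bullet> b" "v \<bullet> b \<noteq> w \<bullet> b" "u \<bullet> b \<noteq> w \<bullet> b" using inj by blast+
    then consider "u \<bullet> b < v \<bullet> b" "v \<bullet> b < w \<bullet> b" | "u \<bullet> b < w \<bullet> b" "w \<bullet> b < v \<bullet> b"
      | "v \<bullet> b < u \<bullet> b" "u \<bullet> b < w \<bullet> b" | "v \<bullet> b < w \<bullet> b" "w \<bullet> b < u \<bullet> b"
      | "w \<bullet> b < u \<bullet> b" "u \<bullet> b < v \<bullet> b" | "w \<bullet> b < v \<bullet> b" "v \<bullet> b < u \<bullet> b" by linarith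
    then show thesis by cases (use uvw(1) that in \<open>auto simp: insert_commute\<close>)
  qed
  define y0 where "y0 = z0 \<bullet> b"
  define y1 where "y1 = z1 \<bullet> b"
  define y2 where "y2 = z2 \<bullet> b"
  have y01: "y0 < y1" "y1 < y2" using y unfolding y0_def y1_def y2_def by auto
  have dist3: "z0 \<noteq> z1" "z1 \<noteq> z2" "z0 \<noteq> z2" using y by auto
  have A0: "a z0 + a z1 + a z2 = 0" using a0 dist3 unfolding D by simp
  have "(\<Sum>z\<in>D. a z *\<^sub>R z) \<bullet> b = 0" using a1 by simp
  then have A1: "a z0 * y0 + a z1 * y1 + a z2 * y2 = 0"
    using dist3 unfolding D y0_def y1_def y2_def by (simp add: inner_add_left)
  have n: "a z0 \<noteq> 0" "a z1 \<noteq> 0" "a z2 \<noteq> 0" using nz D by auto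
  define f where "f s t = a z0 * (t - y0) powr p + a z1 * (s * (t - y1)) powr p + a z2 * (y2 - t) powr p" for s t
  define S where "S = {t \<in> {y1<..<y2}. f 1 t = C} \<union> {t \<in> {y0<..<y1}. f (-1) t = C} \<union> {y1}"
  have c1: "countable {t \<in> {y1<..<y2}. f 1 t = C}" unfolding f_def
    by (rule countable_level_set_three_powers[OF _ _ y01 n A0 A1 p]) (use y01 in auto)
  have c2: "countable {t \<in> {y0<..<y1}. f (-1) t = C}" unfolding f_def
    by (rule countable_level_set_three_powers[OF _ _ y01 n A0 A1 p]) (use y01 in auto)
  have "countable S" unfolding S_def using c1 c2 by simp
  moreover have "{x. (\<exists>u\<in>D. \<exists>w\<in>D. u \<bullet> b < x \<bullet> b \<and> x \<bullet> b < w \<bullet> b) \<and> (\<Sum>z\<in>D. a z * norm (x - z) powr p) = C}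
     \<subseteq> (\<lambda>t. t *\<^sub>R b) ` S"
  proof
    fix x assume "x \<in> {x. (\<exists>u\<in>D. \<exists>w\<in>D. u \<bullet> b < x \<bullet> b \<and> x \<bullet> b < w \<bullet> b) \<and> (\<Sum>z\<in>D. a z * norm (x - z) powr p) = C}"
    then have bet: "y0 < x \<bullet> b" "x \<bullet> b < y2" and eq: "(\<Sum>z\<in>D. a z * norm (x - z) powr p) = C"
      using y unfolding D y0_def y2_def by auto
    have "a z0 * \<bar>x \<bullet> b - y0\<bar> powr p + a z1 * \<bar>x \<bullet> b - y1\<bar> powr p + a z2 * \<bar>x \<bullet> b - y2\<bar> powr p = C"
      using eq dist3 unfolding D nrm inner_diff_left y0_def y1_def y2_def by simp
    then have "x \<bullet> b \<in> S"
      using bet unfolding S_def f_def by (auto simp: abs_if split: if_splits)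
    then show "x \<in> (\<lambda>t. t *\<^sub>R b) ` S" using rep[of x] by blast
  qed
  ultimately have "countable {x. (\<exists>u\<in>D. \<exists>w\<in>D. u \<bullet> b < x \<bullet> b \<and> x \<bullet> b < w \<bullet> b) \<and> (\<Sum>z\<in>D. a z * norm (x - z) powr p) = C}"
    by (meson countable_image countable_subset)
  then show ?thesis by (rule countable_imp_null_set_lborel)
qed

text \<open>
  A circuit of the affine matroid together with the coefficients of its affine dependence, which are
  unique up to scaling.
\<close>

definition circuit :: "'a::euclidean_space set \<Rightarrow> ('a \<Rightarrow> real) \<Rightarrow> bool" where
  "circuit D a \<longleftrightarrow> finite D \<and> (\<forall>z\<in>D. \<not> affine_dependent (D - {z})) \<and> (\<forall>z\<in>D. a z \<noteq> 0) \<and>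
     D \<noteq> {} \<and> (\<Sum>z\<in>D. a z) = 0 \<and> (\<Sum>z\<in>D. a z *\<^sub>R z) = 0"

lemma minimal_affine_dependent_circuit:
  assumes fin: "finite D" and dep: "affine_dependent D"
    and ind: "\<And>z. z \<in> D \<Longrightarrow> \<not> affine_dependent (D - {z})"
  shows "\<exists>a. circuit D a"
proof -
  obtain a where a: "sum a D = 0" "\<exists>v\<in>D. a v \<noteq> 0" "(\<Sum>v\<in>D. a v *\<^sub>R v) = 0"
    using dep unfolding affine_dependent_explicit_finite[OF fin] by blast
  have "a z \<noteq> 0" if z: "z \<in> D" for z
  proof
    assume "a z = 0"
    then have "sum a (D - {z}) = 0" "\<exists>v\<in>D - {z}. a v \<noteq> 0" "(\<Sum>v\<in>D - {z}. a v *\<^sub>R v) = 0"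
      using a fin z by (auto simp: sum_diff1)
    then have "affine_dependent (D - {z})"
      using fin by (subst affine_dependent_explicit_finite) auto
    then show False using ind[OF z] by simp
  qed
  then show ?thesis unfolding circuit_def using a fin ind by (intro exI[of _ a]) auto
qed

lemma affine_dependent_contains_circuit:
  fixes T :: "'a::euclidean_space set"
  assumes "affine_dependent T"
  shows "\<exists>D a. D \<subseteq> T \<and> circuit D a"
proof -
  obtain F where F: "finite F" "F \<subseteq> T" "affine_dependent F"
    using assms unfolding affine_dependent_explicit by blast
  define P where "P D \<longleftrightarrow> finite D \<and> D \<subseteq> T \<and> affine_dependent D" for D
  obtain D where D: "P D" "\<And>D'. P D' \<Longrightarrow> card D \<le> card D'"
    using F ex_has_least_nat[of P F card] unfolding P_def by blast
  have "\<not> affine_dependent (D - {z})" if "z \<in> D" for z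
    using D(2)[of "D - {z}"] D(1) that unfolding P_def
    by (metis Diff_subset card_Diff1_less finite_Diff not_less order_trans)
  then show ?thesis using minimal_affine_dependent_circuit[of D] D(1) unfolding P_def by blast
qed

lemma circuit_card:
  assumes "circuit D a"
  shows "card D \<ge> 3"
proof (rule ccontr)
  have fin: "finite D" and nz: "\<And>z. z \<in> D \<Longrightarrow> a z \<noteq> 0" and ne: "D \<noteq> {}"
    and a: "(\<Sum>z\<in>D. a z) = 0" "(\<Sum>z\<in>D. a z *\<^sub>R z) = 0"
    using assms unfolding circuit_def by auto
  assume "\<not> ?thesis"
  moreover have "card D \<noteq> 0" using fin ne by simp
  ultimately have "card D = 1 \<or> card D = 2" by linarith
  then obtain x y where "D = {x, y}"
    by (metis card_1_singletonE card_2_iff insert_absorb2)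
  then have "\<not> affine_dependent D" by simp
  then show False using a nz ne unfolding affine_dependent_explicit_finite[OF fin] by blast
qed

text \<open>
  The region in which the level sets of a circuit are null.  In dimension one it must leave out the
  points outside the hull of \<open>D\<close>, where a radial sum can be constant; in higher dimensions there is
  no such restriction.
\<close>

definition straddles :: "'a::euclidean_space set \<Rightarrow> 'a set" where
  "straddles D = {x. DIM('a) = 1 \<longrightarrow> (\<forall>b\<in>Basis. \<exists>u\<in>D. \<exists>w\<in>D. u \<bullet> b < x \<bullet> b \<and> x \<bullet> b < w \<bullet> b)}"

lemma circuit_level_set_null:
  fixes D :: "'a::euclidean_space set"
  assumes c: "circuit D a" and p: "p > 0" "p \<noteq> 2"
  shows "{x \<in> straddles D. (\<Sum>z\<in>D. a z * norm (x - z) powr p) = C} \<in> null_sets lborel"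
proof -
  have fin: "finite D" and nz: "\<And>z. z \<in> D \<Longrightarrow> a z \<noteq> 0" and ind: "\<And>z. z \<in> D \<Longrightarrow> \<not> affine_dependent (D - {z})"
    and a: "(\<Sum>z\<in>D. a z) = 0" "(\<Sum>z\<in>D. a z *\<^sub>R z) = 0"
    using c unfolding circuit_def by auto
  have c3: "card D \<ge> 3" by (rule circuit_card[OF c])
  show ?thesis
  proof (cases "DIM('a) = 1")
    case True
    then obtain b :: 'a where b: "Basis = {b}" by (metis card_1_singletonE)
    obtain z where z: "z \<in> D" using c3 by fastforce
    have "card (D - {z}) < DIM('a) + 2"
      using affine_dependent_biggerset[of "D - {z}"] ind[OF z] fin by force
    then have "card D = 3" using c3 z fin True by simp
    then show ?thesis
      using radial_sum_level_set_null_line[OF True _ _ nz a p, of b C] True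
      unfolding straddles_def b by simp
  next
    case False
    then have d: "DIM('a) \<ge> 2" using DIM_positive[where 'a='a] by linarith
    have "straddles D = UNIV" using False unfolding straddles_def by simp
    then show ?thesis using radial_sum_level_set_null[OF d fin c3 ind nz a p] by simp
  qed
qed

section \<open>Disintegrations and atomic reweighting\<close>

locale disintegrated =
  fixes \<mu> :: "'a::euclidean_space measure" and \<pi> :: "('a \<times> 'a) measure" and \<kappa> :: "'a \<Rightarrow> 'a measure"
  assumes prob_mu: "prob_space \<mu>" and sets_mu[measurable_cong]: "sets \<mu> = sets borel"
    and prob_pi: "prob_space \<pi>" and sets_pi[measurable_cong]: "sets \<pi> = sets (borel \<Otimes>\<^sub>M borel)"
    and dis: "disintegration \<mu> \<pi> \<kappa>"
begin

lemma space_mu[simp]: "space \<mu> = UNIV"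
  using sets_eq_imp_space_eq[OF sets_mu] by simp

lemma space_pi[simp]: "space \<pi> = UNIV"
  using sets_eq_imp_space_eq[OF sets_pi] by (simp add: space_pair_measure)

lemma kernel[measurable]: "\<kappa> \<in> borel \<rightarrow>\<^sub>M prob_algebra borel"
  using dis unfolding disintegration_def by simp

lemma kernel_subprob[measurable]: "\<kappa> \<in> borel \<rightarrow>\<^sub>M subprob_algebra borel"
  using kernel by (rule measurable_prob_algebraD)

lemma prob_kernel: "prob_space (\<kappa> x)" and sets_kernel[simp, measurable_cong]: "sets (\<kappa> x) = sets borel"
  using measurable_space[OF kernel, of x] by (auto simp: space_prob_algebra)

lemma space_kernel[simp]: "space (\<kappa> x) = UNIV"
  using sets_eq_imp_space_eq[OF sets_kernel, of x] by simp

lemma emeasure_rect: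
  assumes "A \<in> sets borel" "B \<in> sets borel"
  shows "emeasure \<pi> (A \<times> B) = (\<integral>\<^sup>+ x. emeasure (\<kappa> x) B * indicator A x \<partial>\<mu>)"
  using dis assms unfolding disintegration_def by simp

lemma distr_fst: "distr \<pi> borel fst = \<mu>"
proof (rule measure_eqI)
  show "sets (distr \<pi> borel fst) = sets \<mu>" by (simp add: sets_mu)
  fix A assume "A \<in> sets (distr \<pi> borel fst)"
  then have A[measurable]: "A \<in> sets borel" by simp
  have "emeasure (distr \<pi> borel fst) A = emeasure \<pi> (A \<times> UNIV)"
    by (subst emeasure_distr) (auto intro!: arg_cong[where f="emeasure \<pi>"])
  also have "\<dots> = (\<integral>\<^sup>+ x. indicator A x \<partial>\<mu>)"
    using prob_space.emeasure_space_1[OF prob_kernel] by (subst emeasure_rect) auto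
  also have "\<dots> = emeasure \<mu> A" using A sets_mu by (intro nn_integral_indicator) auto
  finally show "emeasure (distr \<pi> borel fst) A = emeasure \<mu> A" .
qed

text \<open>
  The part of \<open>\<pi>\<close> on the slice \<open>y = z\<close>.  As only integrals over slices at single points occur later, this
  identity of measures replaces the general Fubini theorem for kernels.
\<close>

lemma distr_fst_atom:
  "distr (density \<pi> (\<lambda>w. indicator {z} (snd w))) borel fst = density \<mu> (\<lambda>x. emeasure (\<kappa> x) {z})"
proof (rule measure_eqI)
  show "sets (distr (density \<pi> (\<lambda>w. indicator {z} (snd w))) borel fst) = sets (density \<mu> (\<lambda>x. emeasure (\<kappa> x) {z}))"
    by (simp add: sets_mu)
  fix A assume "A \<in> sets (distr (density \<pi> (\<lambda>w. indicator {z} (snd w))) borel fst)"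
  then have A[measurable]: "A \<in> sets borel" by simp
  have AU: "A \<times> UNIV \<in> sets \<pi>" unfolding sets_pi by measurable
  have im: "(\<lambda>w. indicator {z} (snd w) :: ennreal) \<in> borel_measurable \<pi>" by measurable
  have "emeasure (distr (density \<pi> (\<lambda>w. indicator {z} (snd w))) borel fst) A =
      emeasure (density \<pi> (\<lambda>w. indicator {z} (snd w))) (A \<times> UNIV)"
    by (subst emeasure_distr) (auto intro!: arg_cong[where f="emeasure _"])
  also have "\<dots> = (\<integral>\<^sup>+w. indicator {z} (snd w) * indicator (A \<times> UNIV) w \<partial>\<pi>)"
    by (rule emeasure_density[OF im AU])
  also have "\<dots> = (\<integral>\<^sup>+w. indicator (A \<times> {z}) w \<partial>\<pi>)"
    by (intro nn_integral_cong) (auto split: split_indicator)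
  also have "\<dots> = emeasure \<pi> (A \<times> {z})" by (intro nn_integral_indicator) measurable
  also have "\<dots> = emeasure (density \<mu> (\<lambda>x. emeasure (\<kappa> x) {z})) A"
    using A sets_mu by (subst emeasure_rect) (auto simp: emeasure_density)
  finally show "emeasure (distr (density \<pi> (\<lambda>w. indicator {z} (snd w))) borel fst) A
     = emeasure (density \<mu> (\<lambda>x. emeasure (\<kappa> x) {z})) A" .
qed

lemma integral_atom:
  fixes u :: "'a \<Rightarrow> real"
  assumes u[measurable]: "u \<in> borel_measurable borel"
  shows "(LINT w|\<pi>. indicator {z} (snd w) * u (fst w)) = (LINT x|\<mu>. measure (\<kappa> x) {z} * u x)"
proof -
  have e1: "ennreal (indicator {z} y) = indicator {z} y" for y :: 'a by (auto split: split_indicator)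
  have "(LINT w|\<pi>. indicator {z} (snd w) * u (fst w)) = (LINT w|density \<pi> (\<lambda>w. ennreal (indicator {z} (snd w))). u (fst w))"
    by (subst integral_density) auto
  also have "\<dots> = (LINT x|distr (density \<pi> (\<lambda>w. ennreal (indicator {z} (snd w)))) borel fst. u x)"
    by (subst integral_distr) auto
  also have "\<dots> = (LINT x|density \<mu> (\<lambda>x. ennreal (measure (\<kappa> x) {z})). u x)"
    unfolding e1 distr_fst_atom by (simp add: finite_measure.emeasure_eq_measure[OF prob_space.finite_measure[OF prob_kernel]])
  also have "\<dots> = (LINT x|\<mu>. measure (\<kappa> x) {z} * u x)"
    by (subst integral_density) auto
  finally show ?thesis .
qed

lemma measure_rect:
  assumes A[measurable]: "A \<in> sets borel" and B[measurable]: "B \<in> sets borel"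
  shows "measure \<pi> (A \<times> B) = (LINT x|\<mu>. measure (\<kappa> x) B * indicator A x)"
proof -
  interpret mu: prob_space \<mu> by (rule prob_mu)
  interpret pi: prob_space \<pi> by (rule prob_pi)
  have "integrable \<mu> (\<lambda>x. measure (\<kappa> x) B * indicator A x)"
    using prob_space.prob_le_1[OF prob_kernel]
    by (intro mu.integrable_const_bound[of _ 1]) (auto split: split_indicator)
  then have "ennreal (LINT x|\<mu>. measure (\<kappa> x) B * indicator A x) = (\<integral>\<^sup>+x. ennreal (measure (\<kappa> x) B * indicator A x) \<partial>\<mu>)"
    by (intro nn_integral_eq_integral[symmetric]) auto
  also have "\<dots> = emeasure \<pi> (A \<times> B)"
    unfolding emeasure_rect[OF A B]
    by (intro nn_integral_cong)
      (auto simp: finite_measure.emeasure_eq_measure[OF prob_space.finite_measure[OF prob_kernel]] split: split_indicator)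
  finally have "ennreal (LINT x|\<mu>. measure (\<kappa> x) B * indicator A x) = ennreal (measure \<pi> (A \<times> B))"
    unfolding pi.emeasure_eq_measure .
  moreover have "0 \<le> (LINT x|\<mu>. measure (\<kappa> x) B * indicator A x)"
    by (intro integral_nonneg_AE) auto
  ultimately show ?thesis by simp
qed

end

text \<open>
  The data of an admissible perturbation, which adds the signed measure \<open>h(x) \<Sum> a\<^sub>z \<delta>\<^sub>z\<close> to
  \<open>\<kappa> x\<close>.  The bound \<open>ah\<close> keeps the result nonnegative; it also forces \<open>h\<close> to vanish wherever
  some point of \<open>D\<close> with \<open>a\<^sub>z \<noteq> 0\<close> is not an atom.
\<close>

locale perturbed = disintegrated \<mu> \<pi> \<kappa>
  for \<mu> :: "'a::euclidean_space measure" and \<pi> :: "('a \<times> 'a) measure" and \<kappa> :: "'a \<Rightarrow> 'a measure" +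
  fixes D :: "'a set" and a :: "'a \<Rightarrow> real" and h :: "'a \<Rightarrow> real"
  assumes fin: "finite D"
    and h[measurable]: "h \<in> borel_measurable borel"
    and h_le: "\<And>x. \<bar>h x\<bar> \<le> 1"
    and ah: "\<And>x z. z \<in> D \<Longrightarrow> \<bar>a z * h x\<bar> \<le> measure (\<kappa> x) {z}"
    and h0: "(LINT x|\<mu>. h x) = 0"
    and a0: "(\<Sum>z\<in>D. a z) = 0" and a1: "(\<Sum>z\<in>D. a z *\<^sub>R z) = 0"
begin

text \<open>
  The perturbed kernel has density \<open>1 + tilt x y\<close> with respect to \<open>\<kappa> x\<close>, and the perturbed plan has the
  same density with respect to \<open>\<pi>\<close>; this avoids adding signed measures.
\<close>

definition tilt :: "'a \<Rightarrow> 'a \<Rightarrow> real" where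
  "tilt x y = (\<Sum>z\<in>D. indicator {z} y * (a z * h x / measure (\<kappa> x) {z}))"

definition tilted :: "('a \<times> 'a) measure" where
  "tilted = density \<pi> (\<lambda>w. ennreal (1 + tilt (fst w) (snd w)))"

definition tilted_kernel :: "'a \<Rightarrow> 'a measure" where
  "tilted_kernel x = density (\<kappa> x) (\<lambda>y. ennreal (1 + tilt x y))"

lemma tilt_eq: "tilt x y = (if y \<in> D then a y * h x / measure (\<kappa> x) {y} else 0)"
proof -
  have "tilt x y = (\<Sum>z\<in>D. if z = y then a z * h x / measure (\<kappa> x) {z} else 0)"
    unfolding tilt_def by (intro sum.cong refl) (auto split: split_indicator)
  then show ?thesis using fin by simp
qed

lemma tilt_le: "\<bar>tilt x y\<bar> \<le> 1"
  unfolding tilt_eq using ah[of y x] by (auto simp: abs_divide divide_le_eq_1 measure_nonneg less_le)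

lemma tilt_meas[measurable]: "(\<lambda>w. tilt (fst w) (snd w)) \<in> borel_measurable (borel \<Otimes>\<^sub>M borel)"
  unfolding tilt_def by measurable

lemma tilt_meas2[measurable]: "tilt x \<in> borel_measurable borel"
  unfolding tilt_def by measurable

lemma atom_mult_tilt: "measure (\<kappa> x) {z} * (a z * h x / measure (\<kappa> x) {z}) = a z * h x" if "z \<in> D"
  using ah[OF that, of x] by auto

text \<open>
  The signed measure \<open>tilt x y \<kappa>(x, dy)\<close> is indeed \<open>h(x) \<Sum> a\<^sub>z \<delta>\<^sub>z\<close>.
\<close>

lemma has_integral_kernel_tilt:
  fixes F :: "'a \<Rightarrow> 'c::{banach, second_countable_topology}"
  shows "has_bochner_integral (\<kappa> x) (\<lambda>y. tilt x y *\<^sub>R F y) (\<Sum>z\<in>D. (a z * h x) *\<^sub>R F z)"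
proof -
  interpret k: prob_space "\<kappa> x" by (rule prob_kernel)
  have eq: "tilt x y *\<^sub>R F y = (\<Sum>z\<in>D. indicator {z} y *\<^sub>R ((a z * h x / measure (\<kappa> x) {z}) *\<^sub>R F z))" for y
    unfolding tilt_def scaleR_sum_left by (intro sum.cong refl) (auto split: split_indicator)
  have "has_bochner_integral (\<kappa> x) (\<lambda>y. \<Sum>z\<in>D. indicator {z} y *\<^sub>R ((a z * h x / measure (\<kappa> x) {z}) *\<^sub>R F z))
     (\<Sum>z\<in>D. measure (\<kappa> x) {z} *\<^sub>R ((a z * h x / measure (\<kappa> x) {z}) *\<^sub>R F z))"
    by (intro has_bochner_integral_sum has_bochner_integral_indicator) (auto simp: k.emeasure_eq_measure)
  also have "(\<Sum>z\<in>D. measure (\<kappa> x) {z} *\<^sub>R ((a z * h x / measure (\<kappa> x) {z}) *\<^sub>R F z)) = (\<Sum>z\<in>D. (a z * h x) *\<^sub>R F z)"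
    by (intro sum.cong refl) (simp only: scaleR_scaleR atom_mult_tilt)
  finally show ?thesis unfolding eq .
qed

lemma integral_tilted_kernel:
  fixes F :: "'a \<Rightarrow> 'c::{banach, second_countable_topology}"
  assumes F: "integrable (\<kappa> x) F"
  shows "integrable (tilted_kernel x) F"
    and "(LINT y|tilted_kernel x. F y) = (LINT y|\<kappa> x. F y) + (\<Sum>z\<in>D. (a z * h x) *\<^sub>R F z)"
proof -
  have nn: "0 \<le> 1 + tilt x y" for y using tilt_le[of x y] by linarith
  have [measurable]: "F \<in> borel_measurable (\<kappa> x)" using F by auto
  have gm: "(\<lambda>y. 1 + tilt x y) \<in> borel_measurable (\<kappa> x)" by measurable
  have hb: "has_bochner_integral (\<kappa> x) (\<lambda>y. (1 + tilt x y) *\<^sub>R F y) ((LINT y|\<kappa> x. F y) + (\<Sum>z\<in>D. (a z * h x) *\<^sub>R F z))"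
    unfolding scaleR_add_left scaleR_one
    by (intro has_bochner_integral_add has_integral_kernel_tilt has_bochner_integral_integrable F)
  show "integrable (tilted_kernel x) F"
    unfolding tilted_kernel_def using hb gm nn by (subst integrable_density) (auto simp: has_bochner_integral_iff)
  show "(LINT y|tilted_kernel x. F y) = (LINT y|\<kappa> x. F y) + (\<Sum>z\<in>D. (a z * h x) *\<^sub>R F z)"
    unfolding tilted_kernel_def using hb gm nn by (subst integral_density) (auto simp: has_bochner_integral_iff)
qed

lemma sets_tilted_kernel[simp]: "sets (tilted_kernel x) = sets borel"
  unfolding tilted_kernel_def by simp

lemma space_tilted_kernel[simp]: "space (tilted_kernel x) = UNIV"
  unfolding tilted_kernel_def by simp

lemma emeasure_tilted_kernel:
  assumes B[measurable]: "B \<in> sets borel"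
  shows "emeasure (tilted_kernel x) B = ennreal (measure (\<kappa> x) B + (\<Sum>z\<in>D. a z * h x * indicator B z))"
    and "0 \<le> measure (\<kappa> x) B + (\<Sum>z\<in>D. a z * h x * indicator B z)"
proof -
  interpret k: prob_space "\<kappa> x" by (rule prob_kernel)
  have i: "integrable (\<kappa> x) (indicator B :: 'a \<Rightarrow> real)"
    by (intro integrable_real_indicator) (auto simp: k.emeasure_eq_measure)
  have i2: "integrable (tilted_kernel x) (indicator B :: 'a \<Rightarrow> real)" by (rule integral_tilted_kernel(1)[OF i])
  have eq: "(LINT y|tilted_kernel x. indicator B y) = measure (\<kappa> x) B + (\<Sum>z\<in>D. a z * h x * indicator B z :: real)"
    unfolding integral_tilted_kernel(2)[OF i] by simp
  show "emeasure (tilted_kernel x) B = ennreal (measure (\<kappa> x) B + (\<Sum>z\<in>D. a z * h x * indicator B z))"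
  proof -
    have "emeasure (tilted_kernel x) B = (\<integral>\<^sup>+y. ennreal (indicator B y) \<partial>tilted_kernel x)"
      by (simp add: ennreal_indicator)
    also have "\<dots> = ennreal (LINT y|tilted_kernel x. indicator B y)"
      by (intro nn_integral_eq_integral i2) auto
    finally show ?thesis unfolding eq .
  qed
  show "0 \<le> measure (\<kappa> x) B + (\<Sum>z\<in>D. a z * h x * indicator B z)"
    unfolding eq[symmetric] by (intro integral_nonneg_AE) auto
qed

lemma prob_tilted_kernel: "prob_space (tilted_kernel x)"
proof
  interpret k: prob_space "\<kappa> x" by (rule prob_kernel)
  have "(\<Sum>z\<in>D. a z * h x * indicator UNIV z) = (\<Sum>z\<in>D. a z) * h x"
    by (simp add: sum_distrib_right)
  then show "emeasure (tilted_kernel x) (space (tilted_kernel x)) = 1"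
    using emeasure_tilted_kernel(1)[of UNIV x] a0 k.prob_space by simp
qed

lemma tilted_kernel_measurable: "tilted_kernel \<in> borel \<rightarrow>\<^sub>M prob_algebra borel"
proof (intro measurable_prob_algebraI prob_tilted_kernel measurable_subprob_algebra prob_space_imp_subprob_space sets_tilted_kernel)
  fix B :: "'a set" assume [measurable]: "B \<in> sets borel"
  show "(\<lambda>x. emeasure (tilted_kernel x) B) \<in> borel_measurable borel"
    unfolding emeasure_tilted_kernel(1)[OF \<open>B \<in> sets borel\<close>] by measurable
qed

text \<open>
  The first-order change of an integral; it is exact since the perturbation is linear.
\<close>

lemma integral_tilted:
  fixes f :: "'a \<times> 'a \<Rightarrow> real"
  assumes f: "integrable \<pi> f"
  shows "integrable tilted f"
    and "(LINT w|tilted. f w) = (LINT w|\<pi>. f w) + (\<Sum>z\<in>D. a z * (LINT x|\<mu>. h x * f (x, z)))"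
proof -
  have fm0: "f \<in> borel_measurable \<pi>" using f by auto
  then have fm[measurable]: "f \<in> borel_measurable (borel \<Otimes>\<^sub>M borel)"
    using measurable_cong_sets[OF sets_pi refl] by metis
  have nn: "0 \<le> 1 + tilt (fst w) (snd w)" for w using tilt_le[of "fst w" "snd w"] by linarith
  have gm: "(\<lambda>w. 1 + tilt (fst w) (snd w)) \<in> borel_measurable \<pi>" by measurable
  define u where "u z x = f (x, z) * (a z * h x / measure (\<kappa> x) {z})" for z x
  have um[measurable]: "u z \<in> borel_measurable borel" for z unfolding u_def by measurable
  have eq: "tilt (fst w) (snd w) * f w = (\<Sum>z\<in>D. indicator {z} (snd w) * u z (fst w))" for w
    unfolding tilt_def u_def sum_distrib_right
    by (intro sum.cong refl) (auto split: split_indicator)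
  have gfi: "integrable \<pi> (\<lambda>w. tilt (fst w) (snd w) * f w)"
    by (rule Bochner_Integration.integrable_bound[OF f])
       (auto simp: abs_mult intro!: mult_left_le_one_le tilt_le)
  have ti: "integrable \<pi> (\<lambda>w. indicator {z} (snd w) * u z (fst w))" if z: "z \<in> D" for z
  proof (rule Bochner_Integration.integrable_bound[OF gfi])
    have "indicator {z} (snd w) * u z (fst w) = indicator {z} (snd w) * (tilt (fst w) (snd w) * f w)" for w
      using z unfolding tilt_eq u_def by (auto split: split_indicator)
    then have "norm (indicator {z} (snd w) * u z (fst w)) \<le> norm (tilt (fst w) (snd w) * f w)" for w
      by (simp only:) (simp add: abs_mult mult_left_le_one_le)
    then show "AE w in \<pi>. norm (indicator {z} (snd w) * u z (fst w)) \<le> norm (tilt (fst w) (snd w) * f w)"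
      by (intro AE_I2)
  qed measurable
  have "(LINT w|\<pi>. tilt (fst w) (snd w) * f w) = (\<Sum>z\<in>D. (LINT w|\<pi>. indicator {z} (snd w) * u z (fst w)))"
    unfolding eq by (rule Bochner_Integration.integral_sum) (rule ti)
  also have "\<dots> = (\<Sum>z\<in>D. (LINT x|\<mu>. measure (\<kappa> x) {z} * u z x))"
    by (intro sum.cong refl integral_atom um)
  also have "\<dots> = (\<Sum>z\<in>D. (LINT x|\<mu>. a z * (h x * f (x, z))))"
  proof (intro sum.cong refl Bochner_Integration.integral_cong)
    fix z x assume z: "z \<in> D"
    have "measure (\<kappa> x) {z} * u z x = (measure (\<kappa> x) {z} * (a z * h x / measure (\<kappa> x) {z})) * f (x, z)"
      unfolding u_def by (simp only: mult_ac)
    then show "measure (\<kappa> x) {z} * u z x = a z * (h x * f (x, z))"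
      unfolding atom_mult_tilt[OF z] by simp
  qed
  finally have gI: "(LINT w|\<pi>. tilt (fst w) (snd w) * f w) = (\<Sum>z\<in>D. a z * (LINT x|\<mu>. h x * f (x, z)))" by simp
  have hb: "has_bochner_integral \<pi> (\<lambda>w. (1 + tilt (fst w) (snd w)) *\<^sub>R f w)
    ((LINT w|\<pi>. f w) + (\<Sum>z\<in>D. a z * (LINT x|\<mu>. h x * f (x, z))))"
    unfolding real_scaleR_def distrib_right mult_1_left gI[symmetric]
    by (intro has_bochner_integral_add has_bochner_integral_integrable f gfi)
  show "integrable tilted f"
    unfolding tilted_def using hb gm nn fm0 by (subst integrable_density) (auto simp: has_bochner_integral_iff)
  show "(LINT w|tilted. f w) = (LINT w|\<pi>. f w) + (\<Sum>z\<in>D. a z * (LINT x|\<mu>. h x * f (x, z)))"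
    unfolding tilted_def using hb gm nn fm0 by (subst integral_density) (auto simp: has_bochner_integral_iff)
qed

lemma sets_tilted: "sets tilted = sets (borel \<Otimes>\<^sub>M borel)"
  unfolding tilted_def by (simp add: sets_pi)

lemma space_tilted[simp]: "space tilted = UNIV"
  unfolding tilted_def by simp

lemma emeasure_tilted_rect:
  assumes A[measurable]: "A \<in> sets borel" and B[measurable]: "B \<in> sets borel"
  shows "emeasure tilted (A \<times> B) = ennreal (measure \<pi> (A \<times> B) + (\<Sum>z\<in>D. a z * (LINT x|\<mu>. h x * indicator A x) * indicator B z))"
proof -
  interpret pi: prob_space \<pi> by (rule prob_pi)
  have AB: "A \<times> B \<in> sets \<pi>" unfolding sets_pi by measurable
  have i: "integrable \<pi> (indicator (A \<times> B) :: _ \<Rightarrow> real)"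
    using AB by (intro integrable_real_indicator) (auto simp: pi.emeasure_eq_measure)
  have i2: "integrable tilted (indicator (A \<times> B) :: _ \<Rightarrow> real)" by (rule integral_tilted(1)[OF i])
  have "emeasure tilted (A \<times> B) = (\<integral>\<^sup>+y. ennreal (indicator (A \<times> B) y) \<partial>tilted)"
    using AB by (simp add: ennreal_indicator sets_tilted sets_pi)
  also have "\<dots> = ennreal (LINT y|tilted. indicator (A \<times> B) y)"
    by (intro nn_integral_eq_integral i2) auto
  also have "(LINT y|tilted. indicator (A \<times> B) y) = measure \<pi> (A \<times> B) + (\<Sum>z\<in>D. a z * (LINT x|\<mu>. h x * indicator (A \<times> B) (x, z)))"
    unfolding integral_tilted(2)[OF i] by simp
  also have "(\<Sum>z\<in>D. a z * (LINT x|\<mu>. h x * indicator (A \<times> B) (x, z))) = (\<Sum>z\<in>D. a z * (LINT x|\<mu>. h x * indicator A x) * indicator B z)"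
    by (intro sum.cong refl) (auto simp: indicator_times split: split_indicator)
  finally show ?thesis .
qed

lemma disintegration_tilted: "disintegration \<mu> tilted tilted_kernel"
  unfolding disintegration_def
proof (intro conjI ballI tilted_kernel_measurable)
  interpret mu: prob_space \<mu> by (rule prob_mu)
  fix A B :: "'a set" assume [measurable]: "A \<in> sets borel" "B \<in> sets borel"
  define m where "m x = measure (\<kappa> x) B + (\<Sum>z\<in>D. a z * h x * indicator B z)" for x
  have i1: "integrable \<mu> (\<lambda>x. measure (\<kappa> x) B * indicator A x)"
    using prob_space.prob_le_1[OF prob_kernel]
    by (intro mu.integrable_const_bound[of _ 1]) (auto split: split_indicator)
  have i2: "integrable \<mu> (\<lambda>x. h x * indicator A x)"
    using h_le by (intro mu.integrable_const_bound[of _ 1]) (auto split: split_indicator)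
  have meq: "m x * indicator A x = measure (\<kappa> x) B * indicator A x + (\<Sum>z\<in>D. (a z * indicator B z) * (h x * indicator A x))" for x
    unfolding m_def distrib_right sum_distrib_right by (simp add: mult_ac)
  have hb: "has_bochner_integral \<mu> (\<lambda>x. m x * indicator A x)
     ((LINT x|\<mu>. measure (\<kappa> x) B * indicator A x) + (\<Sum>z\<in>D. (a z * indicator B z) * (LINT x|\<mu>. h x * indicator A x)))"
    unfolding meq
    by (intro has_bochner_integral_add has_bochner_integral_sum has_bochner_integral_mult_right has_bochner_integral_integrable i1 i2)
  have mi: "integrable \<mu> (\<lambda>x. m x * indicator A x)" using hb by (simp add: has_bochner_integral_iff)
  have nn: "0 \<le> m x" for x unfolding m_def by (rule emeasure_tilted_kernel(2)) simp
  have "(\<integral>\<^sup>+ x. emeasure (tilted_kernel x) B * indicator A x \<partial>\<mu>) = (\<integral>\<^sup>+ x. ennreal (m x * indicator A x) \<partial>\<mu>)"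
    by (intro nn_integral_cong) (auto simp: emeasure_tilted_kernel(1) m_def split: split_indicator)
  also have "\<dots> = ennreal (LINT x|\<mu>. m x * indicator A x)"
    using nn by (intro nn_integral_eq_integral mi) auto
  also have "(LINT x|\<mu>. m x * indicator A x) = measure \<pi> (A \<times> B) + (\<Sum>z\<in>D. a z * (LINT x|\<mu>. h x * indicator A x) * indicator B z)"
    using hb unfolding measure_rect[OF \<open>A \<in> sets borel\<close> \<open>B \<in> sets borel\<close>]
    by (simp add: has_bochner_integral_iff mult_ac)
  finally show "emeasure tilted (A \<times> B) = (\<integral>\<^sup>+ x. emeasure (tilted_kernel x) B * indicator A x \<partial>\<mu>)"
    unfolding emeasure_tilted_rect[OF \<open>A \<in> sets borel\<close> \<open>B \<in> sets borel\<close>] by simp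
qed

text \<open>
  The mass moved at \<open>z\<close> is \<open>a\<^sub>z \<integral> h d\<mu> = 0\<close>.
\<close>

lemma emeasure_tilted_snd:
  assumes B: "B \<in> sets borel"
  shows "emeasure tilted (UNIV \<times> B) = emeasure \<pi> (UNIV \<times> B)"
proof -
  interpret pi: prob_space \<pi> by (rule prob_pi)
  have "(LINT x|\<mu>. h x * indicator UNIV x) = 0" using h0 by simp
  then have "emeasure tilted (UNIV \<times> B) = ennreal (measure \<pi> (UNIV \<times> B))"
    using emeasure_tilted_rect[OF _ B, of UNIV] by simp
  then show ?thesis unfolding pi.emeasure_eq_measure .
qed

lemma prob_tilted: "prob_space tilted"
proof
  interpret pi: prob_space \<pi> by (rule prob_pi)
  show "emeasure tilted (space tilted) = 1"
    using emeasure_tilted_snd[of UNIV] pi.emeasure_space_1 by simp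
qed

lemma distr_snd_tilted: "distr tilted borel snd = distr \<pi> borel snd"
proof (rule measure_eqI)
  fix B assume "B \<in> sets (distr tilted borel snd)"
  then have B: "B \<in> sets borel" by simp
  have m: "snd \<in> tilted \<rightarrow>\<^sub>M borel" "snd \<in> \<pi> \<rightarrow>\<^sub>M borel"
    by (auto simp: measurable_cong_sets[OF sets_tilted refl] measurable_cong_sets[OF sets_pi refl])
  have vs: "snd -` B = (UNIV :: 'a set) \<times> B" by auto
  have e1: "emeasure (distr tilted borel snd) B = emeasure tilted (UNIV \<times> B)"
    using emeasure_distr[OF m(1) B] by (simp only: vs space_tilted Int_UNIV_right)
  have e2: "emeasure (distr \<pi> borel snd) B = emeasure \<pi> (UNIV \<times> B)"
    using emeasure_distr[OF m(2) B] by (simp only: vs space_pi Int_UNIV_right)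
  show "emeasure (distr tilted borel snd) B = emeasure (distr \<pi> borel snd) B"
    unfolding e1 e2 by (rule emeasure_tilted_snd[OF B])
qed simp

lemma barycenter_tilted_kernel:
  assumes "has_barycenter (\<kappa> x) x"
  shows "has_barycenter (tilted_kernel x) x"
proof -
  have i: "integrable (\<kappa> x) (\<lambda>y. y)" and e: "(LINT y|\<kappa> x. y) = x"
    using assms unfolding has_barycenter_def by auto
  have "(\<Sum>z\<in>D. (a z * h x) *\<^sub>R z) = h x *\<^sub>R (\<Sum>z\<in>D. a z *\<^sub>R z)"
    by (simp add: scaleR_sum_right mult.commute)
  then show ?thesis using integral_tilted_kernel[OF i] e a1 unfolding has_barycenter_def by simp
qed

lemma tilted_MT:
  assumes "distr \<pi> borel snd = \<nu>" "AE x in \<mu>. has_barycenter (\<kappa> x) x"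
  shows "tilted \<in> MT \<mu> \<nu>"
proof -
  interpret P: disintegrated \<mu> tilted tilted_kernel
    by (intro disintegrated.intro prob_mu sets_mu prob_tilted sets_tilted disintegration_tilted)
  have "AE x in \<mu>. has_barycenter (tilted_kernel x) x"
    using assms(2) by eventually_elim (rule barycenter_tilted_kernel)
  then show ?thesis
    unfolding MT_def using prob_tilted sets_tilted P.distr_fst distr_snd_tilted assms(1) disintegration_tilted by auto
qed

end

section \<open>Stationarity of optimal plans\<close>

lemma power_cost_measurable[measurable]:
  "(\<lambda>w. power_cost p (fst w) (snd w)) \<in> borel_measurable (borel \<Otimes>\<^sub>M borel)"
  "(\<lambda>x. power_cost p x z) \<in> borel_measurable borel"
  unfolding power_cost_def by measurable

lemma transport_cost_nonneg_cost:
  assumes "\<And>x y. 0 \<le> c x y"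
  shows "transport_cost c \<pi> = enn2ereal (\<integral>\<^sup>+w. ennreal (c (fst w) (snd w)) \<partial>\<pi>)"
proof -
  have "ennreal (- c x y) = 0" for x y using assms[of x y] by (simp add: ennreal_neg)
  then show ?thesis unfolding transport_cost_def ext_integral_def by (simp add: case_prod_beta' zero_ennreal.rep_eq)
qed

lemma transport_cost_eq_integral:
  assumes "\<And>x y. 0 \<le> c x y" and i: "integrable \<pi> (\<lambda>w. c (fst w) (snd w))"
  shows "transport_cost c \<pi> = ereal (LINT w|\<pi>. c (fst w) (snd w))"
  unfolding transport_cost_nonneg_cost[of c, OF assms(1)]
  using assms by (subst nn_integral_eq_integral) (auto simp: enn2ereal_ennreal integral_nonneg_AE)

lemma transport_cost_finite_imp_integrable:
  assumes "\<And>x y. 0 \<le> c x y" and m: "(\<lambda>w. c (fst w) (snd w)) \<in> borel_measurable \<pi>"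
    and f: "\<bar>transport_cost c \<pi>\<bar> \<noteq> \<infinity>"
  shows "integrable \<pi> (\<lambda>w. c (fst w) (snd w))"
proof (rule integrableI_nonneg[OF m])
  show "AE w in \<pi>. 0 \<le> c (fst w) (snd w)" using assms(1) by simp
  have "enn2ereal (\<integral>\<^sup>+w. ennreal (c (fst w) (snd w)) \<partial>\<pi>) \<noteq> \<infinity>"
    using f unfolding transport_cost_nonneg_cost[of c, OF assms(1)] by auto
  then show "(\<integral>\<^sup>+w. ennreal (c (fst w) (snd w)) \<partial>\<pi>) < \<infinity>"
    by (auto simp: less_top[symmetric] top_ennreal.rep_eq)
qed

text \<open>
  Both problems at once: every competitor used below either comes together with its opposite or has the
  same cost, so that the sense of the optimization does not matter.
\<close>

definition MT_optimal :: "('a::euclidean_space \<Rightarrow> 'a \<Rightarrow> real) \<Rightarrow> 'a measure \<Rightarrow> 'a measure \<Rightarrow> ('a \<times> 'a) measure set \<Rightarrow> bool" where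
  "MT_optimal c \<mu> \<nu> Opt \<longleftrightarrow> Opt = MT_minimizers c \<mu> \<nu> \<or> Opt = MT_maximizers c \<mu> \<nu>"

text \<open>
  The perturbations by \<open>h\<close> and by \<open>-h\<close> change the cost by opposite amounts.
\<close>

lemma optimal_stationary:
  assumes opt: "MT_optimal c \<mu> \<nu> Opt" "\<pi> \<in> Opt"
    and c: "\<And>x y. 0 \<le> c x y" "(\<lambda>w. c (fst w) (snd w)) \<in> borel_measurable (borel \<Otimes>\<^sub>M borel)"
    and bar: "AE x in \<mu>. has_barycenter (\<kappa> x) x"
    and tilted: "perturbed \<mu> \<pi> \<kappa> D a h"
  shows "(\<Sum>z\<in>D. a z * (LINT x|\<mu>. h x * c x z)) = 0"
proof -
  interpret P: perturbed \<mu> \<pi> \<kappa> D a h by (rule tilted)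
  interpret Q: perturbed \<mu> \<pi> \<kappa> D a "\<lambda>x. - h x"
    using P.fin P.h P.h_le P.ah P.h0 P.a0 P.a1
    by (intro perturbed.intro perturbed_axioms.intro P.disintegrated_axioms) auto
  have MT: "\<pi> \<in> MT \<mu> \<nu>" and fin: "\<bar>transport_cost c \<pi>\<bar> \<noteq> \<infinity>"
    using opt unfolding MT_optimal_def MT_minimizers_def MT_maximizers_def by auto
  have cm: "(\<lambda>w. c (fst w) (snd w)) \<in> borel_measurable \<pi>"
    using c(2) measurable_cong_sets[OF P.sets_pi refl] by metis
  have i: "integrable \<pi> (\<lambda>w. c (fst w) (snd w))"
    using c(1) by (rule transport_cost_finite_imp_integrable[OF _ cm fin])
  have snd: "distr \<pi> borel snd = \<nu>" using MT unfolding MT_def by simp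
  note PM = P.tilted_MT[OF snd bar] and QM = Q.tilted_MT[OF snd bar]
  define K where "K = (\<Sum>z\<in>D. a z * (LINT x|\<mu>. h x * c x z))"
  define I where "I = (LINT w|\<pi>. c (fst w) (snd w))"
  have "transport_cost c \<pi> = ereal I"
    unfolding I_def by (rule transport_cost_eq_integral[OF c(1) i])
  moreover have "transport_cost c P.tilted = ereal (I + K)"
    using transport_cost_eq_integral[OF c(1) P.integral_tilted(1)[OF i]] P.integral_tilted(2)[OF i]
    unfolding I_def K_def by simp
  moreover have "transport_cost c Q.tilted = ereal (I - K)"
    using transport_cost_eq_integral[OF c(1) Q.integral_tilted(1)[OF i]] Q.integral_tilted(2)[OF i]
    unfolding I_def K_def by (simp add: sum_negf)
  ultimately have "(I \<le> I + K \<and> I \<le> I - K) \<or> (I + K \<le> I \<and> I - K \<le> I)"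
    using opt PM QM unfolding MT_optimal_def MT_minimizers_def MT_maximizers_def
    by (metis (no_types, lifting) ereal_less_eq(3) mem_Collect_eq)
  then have "K = 0" by linarith
  then show ?thesis unfolding K_def .
qed

lemma open_straddles: "finite D \<Longrightarrow> open (straddles D)"
proof -
  assume "finite D"
  have "straddles D = (if DIM('a) = 1 then (\<Inter>b\<in>Basis. \<Union>u\<in>D. \<Union>w\<in>D. {x. u \<bullet> b < x \<bullet> b} \<inter> {x. x \<bullet> b < w \<bullet> b}) else UNIV)"
    for D :: "'a set" unfolding straddles_def by auto
  then show ?thesis
    by (auto intro!: open_INT open_UN open_Int open_Collect_less continuous_intros)
qed

text \<open>
  Stationarity against \<open>h = \<epsilon> 1\<^sub>A (F - m)\<close>, where \<open>m\<close> is the mean of \<open>F\<close> on \<open>A\<close>, says that the variance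
  of \<open>F\<close> on \<open>A\<close> is zero.  So \<open>A\<close> is, up to a null set, contained in a level set of \<open>F\<close>.
\<close>

lemma (in disintegrated) circuit_atoms_null:
  assumes opt: "MT_optimal (power_cost p) \<mu> \<nu> Opt" "\<pi> \<in> Opt"
    and bar: "AE x in \<mu>. has_barycenter (\<kappa> x) x"
    and ac: "absolutely_continuous lborel \<mu>"
    and p: "p > 0" "p \<noteq> 2"
    and circ: "circuit D a" and d: "\<delta> > 0"
  shows "{x \<in> straddles D. norm x \<le> r \<and> (\<forall>z\<in>D. \<delta> \<le> measure (\<kappa> x) {z})} \<in> null_sets \<mu>"
proof -
  interpret mu: prob_space \<mu> by (rule prob_mu)
  have fin: "finite D" and a0: "(\<Sum>z\<in>D. a z) = 0" and a1: "(\<Sum>z\<in>D. a z *\<^sub>R z) = 0"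
    using circ unfolding circuit_def by auto
  define A where "A = {x \<in> straddles D. norm x \<le> r \<and> (\<forall>z\<in>D. \<delta> \<le> measure (\<kappa> x) {z})}"
  have [measurable]: "straddles D \<in> sets borel" using open_straddles[OF fin] by simp
  have [measurable]: "{x. \<forall>z\<in>D. \<delta> \<le> measure (\<kappa> x) {z}} \<in> sets borel"
  proof -
    have "{x. \<forall>z\<in>D. \<delta> \<le> measure (\<kappa> x) {z}} = space borel \<inter> (\<Inter>z\<in>D. {x\<in>space borel. \<delta> \<le> measure (\<kappa> x) {z}})" by auto
    also have "\<dots> \<in> sets borel"
      using fin by (intro sets.countable_INT'' sets.Int sets.finite_INT) (auto intro: countable_finite)
    finally show ?thesis .
  qed
  have Aeq: "A = straddles D \<inter> {x. norm x \<le> r} \<inter> {x. \<forall>z\<in>D. \<delta> \<le> measure (\<kappa> x) {z}}"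
    unfolding A_def by auto
  have Am[measurable]: "A \<in> sets borel" unfolding Aeq by measurable
  define F where "F x = (\<Sum>z\<in>D. a z * power_cost p x z)" for x
  have Fm[measurable]: "F \<in> borel_measurable borel" unfolding F_def by measurable
  define R where "R z = (\<bar>r\<bar> + norm z) powr p" for z :: 'a
  have cb: "\<bar>power_cost p x z\<bar> \<le> R z" if "x \<in> A" for x z
  proof -
    have "norm (x - z) \<le> \<bar>r\<bar> + norm z" using that norm_triangle_ineq4[of x z] unfolding A_def by auto
    then show ?thesis unfolding power_cost_def R_def using p by (auto intro!: powr_mono2)
  qed
  define K where "K = (\<Sum>z\<in>D. \<bar>a z\<bar> * R z)"
  have Fb: "\<bar>F x\<bar> \<le> K" if x: "x \<in> A" for x
    unfolding F_def K_def using cb[OF x]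
    by (intro order_trans[OF sum_abs] sum_mono) (auto simp: abs_mult intro: mult_left_mono)
  have K0: "K \<ge> 0" unfolding K_def R_def by (intro sum_nonneg) auto
  define m where "m = (LINT x|\<mu>. indicator A x * F x) / measure \<mu> A"
  define N where "N = (\<Sum>z\<in>D. \<bar>a z\<bar>)"
  have aN: "\<bar>a z\<bar> \<le> N" if "z \<in> D" for z unfolding N_def using fin that by (intro member_le_sum) auto
  have N0: "N \<ge> 0" unfolding N_def by (intro sum_nonneg) auto
  define L where "L = K + \<bar>m\<bar> + 1"
  have L1: "L \<ge> 1" unfolding L_def using K0 by simp
  \<comment> \<open>Small enough for \<open>|h| \<le> 1\<close> and for \<open>|a\<^sub>z h| \<le> \<delta>\<close>, a lower bound for the masses of the atoms in \<open>D\<close>.\<close>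
  define \<epsilon> where "\<epsilon> = min \<delta> 1 / (L * (N + 1))"
  have e0: "\<epsilon> > 0" unfolding \<epsilon>_def using d L1 N0 by (intro divide_pos_pos mult_pos_pos) auto
  have eLN: "\<epsilon> * L * (N + 1) = min \<delta> 1" unfolding \<epsilon>_def using L1 N0 by simp
  have eL: "\<epsilon> * L \<le> 1" "N * (\<epsilon> * L) \<le> \<delta>"
  proof -
    have "\<epsilon> * L + N * (\<epsilon> * L) = min \<delta> 1" using eLN by (simp add: algebra_simps)
    moreover have "0 \<le> \<epsilon> * L" "0 \<le> N * (\<epsilon> * L)" using e0 L1 N0 by auto
    ultimately show "\<epsilon> * L \<le> 1" "N * (\<epsilon> * L) \<le> \<delta>" by auto
  qed
  define h where "h x = \<epsilon> * (indicator A x * (F x - m))" for x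
  have hm[measurable]: "h \<in> borel_measurable borel" unfolding h_def by measurable
  have hL: "\<bar>h x\<bar> \<le> \<epsilon> * L" for x
  proof (cases "x \<in> A")
    case True
    then have "\<bar>F x - m\<bar> \<le> L" using Fb[OF True] unfolding L_def by linarith
    then show ?thesis using True e0 unfolding h_def by (simp add: abs_mult)
  next
    case False
    then show ?thesis using e0 L1 unfolding h_def by simp
  qed
  have iF: "integrable \<mu> (\<lambda>x. indicator A x * F x)"
    using Fb K0 by (intro mu.integrable_const_bound[of _ K]) (auto split: split_indicator)
  have iA: "integrable \<mu> (indicator A :: 'a \<Rightarrow> real)"
    by (intro integrable_real_indicator) (auto simp: sets_mu mu.emeasure_eq_measure)
  show ?thesis
  proof (rule ccontr)
    assume "\<not> ?thesis"
    then have "emeasure \<mu> A \<noteq> 0" unfolding A_def[symmetric] by (auto simp: null_sets_def sets_mu)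
    then have mA: "measure \<mu> A \<noteq> 0" by (simp add: mu.emeasure_eq_measure)
    have h1: "(LINT x|\<mu>. indicator A x * (F x - m)) = 0"
    proof -
      have "(LINT x|\<mu>. indicator A x * (F x - m)) = (LINT x|\<mu>. indicator A x * F x - m * indicator A x)"
        by (intro Bochner_Integration.integral_cong) (auto simp: algebra_simps)
      also have "\<dots> = (LINT x|\<mu>. indicator A x * F x) - m * measure \<mu> A"
        using iF iA by (subst Bochner_Integration.integral_diff) (auto simp: sets_mu)
      finally show ?thesis unfolding m_def using mA by simp
    qed
    have h0: "(LINT x|\<mu>. h x) = 0" unfolding h_def using h1 by simp
    have "perturbed \<mu> \<pi> \<kappa> D a h"
    proof (intro perturbed.intro perturbed_axioms.intro disintegrated_axioms fin hm h0 a0 a1)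
      show "\<bar>h x\<bar> \<le> 1" for x using hL[of x] eL by linarith
      fix x z assume z: "z \<in> D"
      show "\<bar>a z * h x\<bar> \<le> measure (\<kappa> x) {z}"
      proof (cases "x \<in> A")
        case True
        have "\<bar>a z * h x\<bar> \<le> N * (\<epsilon> * L)"
          unfolding abs_mult using aN[OF z] hL[of x] N0 by (intro mult_mono) auto
        also have "\<dots> \<le> \<delta>" by (rule eL)
        also have "\<dots> \<le> measure (\<kappa> x) {z}" using True z unfolding A_def by auto
        finally show ?thesis .
      qed (simp add: h_def)
    qed
    then have st: "(\<Sum>z\<in>D. a z * (LINT x|\<mu>. h x * power_cost p x z)) = 0"
      by (intro optimal_stationary[OF opt _ _ bar]) (auto simp: power_cost_def[abs_def])
    have ih: "integrable \<mu> (\<lambda>x. h x * power_cost p x z)" for z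
    proof (rule mu.integrable_const_bound[of _ "\<epsilon> * L * R z"])
      have "\<bar>h x * power_cost p x z\<bar> \<le> \<epsilon> * L * R z" for x
      proof (cases "x \<in> A")
        case True
        show ?thesis unfolding abs_mult using hL[of x] cb[OF True, of z] e0 L1 by (intro mult_mono) auto
      next
        case False
        then show ?thesis using e0 L1 unfolding h_def R_def by simp
      qed
      then show "AE x in \<mu>. norm (h x * power_cost p x z) \<le> \<epsilon> * L * R z" by simp
    qed measurable
    have "(LINT x|\<mu>. h x * F x) = (LINT x|\<mu>. (\<Sum>z\<in>D. a z * (h x * power_cost p x z)))"
      by (intro Bochner_Integration.integral_cong refl) (simp add: F_def sum_distrib_left mult_ac)
    also have "\<dots> = (\<Sum>z\<in>D. a z * (LINT x|\<mu>. h x * power_cost p x z))"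
      using ih by (subst Bochner_Integration.integral_sum) auto
    finally have hF: "(LINT x|\<mu>. h x * F x) = 0" using st by simp
    have ihm: "integrable \<mu> (\<lambda>x. h x * m)"
      using hL by (intro integrable_mult_left mu.integrable_const_bound[of _ "\<epsilon> * L"]) auto
    have ihF: "integrable \<mu> (\<lambda>x. h x * F x)"
    proof (rule mu.integrable_const_bound[of _ "\<epsilon> * L * K"])
      have "\<bar>h x * F x\<bar> \<le> \<epsilon> * L * K" for x
      proof (cases "x \<in> A")
        case True
        show ?thesis unfolding abs_mult using hL[of x] Fb[OF True] e0 L1 by (intro mult_mono) auto
      next
        case False
        then show ?thesis using e0 L1 K0 unfolding h_def by simp
      qed
      then show "AE x in \<mu>. norm (h x * F x) \<le> \<epsilon> * L * K" by simp
    qed measurable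
    have sq: "h x * F x - h x * m = \<epsilon> * (indicator A x * (F x - m)\<^sup>2)" for x
      unfolding h_def by (simp add: power2_eq_square algebra_simps)
    have "(LINT x|\<mu>. \<epsilon> * (indicator A x * (F x - m)\<^sup>2)) = 0"
      unfolding sq[symmetric] using ihF ihm hF h0 by (subst Bochner_Integration.integral_diff) auto
    moreover have "integrable \<mu> (\<lambda>x. \<epsilon> * (indicator A x * (F x - m)\<^sup>2))"
      unfolding sq[symmetric] using ihF ihm by auto
    ultimately have "AE x in \<mu>. \<epsilon> * (indicator A x * (F x - m)\<^sup>2) = 0"
      using e0 by (subst (asm) integral_nonneg_eq_0_iff_AE) auto
    then have AE1: "AE x in \<mu>. x \<in> A \<longrightarrow> F x = m"
      by eventually_elim (use e0 in \<open>auto split: split_indicator_asm\<close>)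
    have "{x \<in> straddles D. (\<Sum>z\<in>D. a z * norm (x - z) powr p) = m} \<in> null_sets \<mu>"
      using circuit_level_set_null[OF circ p] ac unfolding absolutely_continuous_def by auto
    then have "AE x in \<mu>. x \<notin> {x \<in> straddles D. (\<Sum>z\<in>D. a z * norm (x - z) powr p) = m}"
      by (rule AE_not_in)
    with AE1 have "AE x in \<mu>. x \<notin> A"
      by eventually_elim (auto simp: A_def F_def power_cost_def)
    then have "A \<in> null_sets \<mu>"
      by (subst (asm) AE_iff_null_sets[symmetric]) (auto simp: sets_mu)
    then show False using mA by (auto simp: null_sets_def measure_def)
  qed
qed

section \<open>Atomic measures with prescribed barycenter\<close>

definition atoms :: "'a::topological_space measure \<Rightarrow> 'a set" where
  "atoms M = {z. measure M {z} > 0}"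

lemma atoms_subset:
  fixes M :: "'a::euclidean_space measure"
  assumes "AE y in M. y \<in> S" "sets M = sets borel"
  shows "atoms M \<subseteq> S"
proof
  fix z assume z: "z \<in> atoms M"
  show "z \<in> S"
  proof (rule ccontr)
    assume "z \<notin> S"
    have ae: "AE y in M. y \<notin> {z}" using assms(1) by eventually_elim (use \<open>z \<notin> S\<close> in auto)
    have "{z} \<in> null_sets M"
      using assms(2) by (intro AE_iff_null_sets[THEN iffD2, OF _ ae]) auto
    then show False using z unfolding atoms_def by (auto simp: null_sets_def measure_def)
  qed
qed

lemma AE_atoms:
  fixes M :: "'a::euclidean_space measure"
  assumes "prob_space M" and S: "AE y in M. y \<in> S" "countable S" and sets: "sets M = sets borel"
  shows "AE y in M. y \<in> atoms M"
proof -
  interpret prob_space M by fact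
  have "AE y in M. \<forall>z\<in>S - atoms M. y \<noteq> z"
  proof (subst AE_ball_countable)
    show "countable (S - atoms M)" using S by simp
    show "\<forall>z\<in>S - atoms M. AE y in M. y \<noteq> z"
    proof
      fix z assume "z \<in> S - atoms M"
      then have "measure M {z} = 0" unfolding atoms_def by (simp add: not_less measure_le_0_iff)
      then have "{z} \<in> null_sets M" using sets by (auto simp: null_sets_def emeasure_eq_measure)
      then show "AE y in M. y \<noteq> z" using AE_not_in by fastforce
    qed
  qed
  with S(1) show ?thesis by eventually_elim auto
qed

lemma measure_eqI_atoms:
  fixes M N :: "'a::euclidean_space measure"
  assumes "countable S" "sets M = sets borel" "sets N = sets borel"
    and "AE y in M. y \<in> S" "AE y in N. y \<in> S"
    and eq: "\<And>z. z \<in> S \<Longrightarrow> emeasure M {z} = emeasure N {z}"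
  shows "M = N"
proof (rule measure_eqI)
  show "sets M = sets N" using assms by simp
  fix B assume "B \<in> sets M"
  then have B: "B \<in> sets borel" using assms by simp
  have "S \<in> sets borel" by (rule sets.countable[OF _ assms(1)]) simp
  with B have BS: "B \<inter> S \<in> sets borel" by (rule sets.Int)
  have "emeasure M B = emeasure M (B \<inter> S)"
    using assms B BS by (intro emeasure_eq_AE) auto
  also have "\<dots> = (\<integral>\<^sup>+z. emeasure M {z} \<partial>count_space (B \<inter> S))"
    using assms by (intro emeasure_countable_singleton) auto
  also have "\<dots> = (\<integral>\<^sup>+z. emeasure N {z} \<partial>count_space (B \<inter> S))"
    using eq by (intro nn_integral_cong) auto
  also have "\<dots> = emeasure N (B \<inter> S)"
    using assms by (intro emeasure_countable_singleton[symmetric]) auto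
  also have "\<dots> = emeasure N B"
    using assms B BS by (intro emeasure_eq_AE) auto
  finally show "emeasure M B = emeasure N B" .
qed

lemma barycenter_inner:
  fixes M :: "'a::euclidean_space measure"
  assumes "has_barycenter M x"
  shows "integrable M (\<lambda>y. y \<bullet> b)" "(LINT y|M. y \<bullet> b) = x \<bullet> b"
  using assms unfolding has_barycenter_def by auto

text \<open>
  In dimension one, a barycenter outside \<open>S\<close> has atoms strictly on both sides; any third atom completes
  such a pair to a circuit, as two distinct points are affinely independent and three points on a line
  are not.
\<close>

lemma dependent_atoms_contain_straddling_circuit:
  fixes M :: "'a::euclidean_space measure"
  assumes M: "prob_space M" "AE y in M. y \<in> S" "countable S" "sets M = sets borel"
    and bar: "has_barycenter M x" and x: "x \<notin> S" and dep: "affine_dependent (atoms M)"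
  shows "\<exists>D a. D \<subseteq> atoms M \<and> circuit D a \<and> x \<in> straddles D"
proof (cases "DIM('a) = 1")
  case False
  then show ?thesis using affine_dependent_contains_circuit[OF dep] unfolding straddles_def by auto
next
  case True
  interpret prob_space M by fact
  obtain b :: 'a where b: "Basis = {b}" using True by (metis card_1_singletonE)
  have inj: "y = z" if "y \<bullet> b = z \<bullet> b" for y z :: 'a
    by (rule euclidean_eqI) (use that b in auto)
  have no_side: False if side: "\<And>y. y \<in> atoms M \<Longrightarrow> 0 \<le> s * (y \<bullet> b - x \<bullet> b)" and s: "s \<noteq> 0" for s :: real
  proof -
    have i: "integrable M (\<lambda>y. s * (y \<bullet> b - x \<bullet> b))" using barycenter_inner(1)[OF bar] by auto
    have "AE y in M. 0 \<le> s * (y \<bullet> b - x \<bullet> b)"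
      using AE_atoms[OF M] by eventually_elim (rule side)
    moreover have "(LINT y|M. s * (y \<bullet> b - x \<bullet> b)) = 0"
      using barycenter_inner[OF bar] prob_space by simp
    ultimately have "AE y in M. s * (y \<bullet> b - x \<bullet> b) = 0"
      by (metis (no_types, lifting) integral_nonneg_eq_0_iff_AE[OF i])
    with M(2) have "AE y in M. False"
      by eventually_elim (use s inj x in auto)
    then show False by simp
  qed
  obtain u where u: "u \<in> atoms M" "u \<bullet> b < x \<bullet> b" using no_side[of 1] by force
  obtain w where w: "w \<in> atoms M" "x \<bullet> b < w \<bullet> b" using no_side[of "-1"] by force
  have "atoms M \<noteq> {u, w}" using dep affine_independent_2 by metis
  then obtain v where v: "v \<in> atoms M" "v \<noteq> u" "v \<noteq> w" using u w by blast
  define D where "D = {u, v, w}"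
  have uw: "u \<noteq> w" using u w by auto
  have "card D = 3" unfolding D_def using v uw by auto
  then have "affine_dependent D" unfolding D_def using True by (intro affine_dependent_biggerset) auto
  moreover have "\<not> affine_dependent (D - {z})" if "z \<in> D" for z
  proof -
    have "D - {z} = {u, v} \<or> D - {z} = {v, w} \<or> D - {z} = {u, w}" using that v uw unfolding D_def by auto
    then show ?thesis using affine_independent_2 by metis
  qed
  ultimately obtain a where "circuit D a" using minimal_affine_dependent_circuit[of D] unfolding D_def by auto
  moreover have "x \<in> straddles D" using u w unfolding straddles_def b D_def by auto
  ultimately show ?thesis using u v w by (intro exI[of _ D] exI[of _ a]) (auto simp: D_def)
qed

lemma msupport_finite_atoms:
  fixes M :: "'a::euclidean_space measure"
  assumes M: "prob_space M" "AE y in M. y \<in> S" "countable S" "sets M = sets borel"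
    and fin: "finite (atoms M)"
  shows "msupport M = atoms M"
proof (intro equalityI subsetI)
  interpret prob_space M by fact
  fix x assume x: "x \<in> msupport M"
  show "x \<in> atoms M"
  proof (rule ccontr)
    assume n: "x \<notin> atoms M"
    have o: "open (- atoms M)" using fin by (simp add: finite_imp_closed open_Compl)
    have ae: "AE y in M. y \<notin> - atoms M" using AE_atoms[OF M] by simp
    have "- atoms M \<in> null_sets M"
      using o M(4) by (intro AE_iff_null_sets[THEN iffD2, OF _ ae]) auto
    then show False using x n o unfolding msupport_def by (auto simp: null_sets_def)
  qed
next
  interpret prob_space M by fact
  fix x assume x: "x \<in> atoms M"
  show "x \<in> msupport M" unfolding msupport_def
  proof (clarify)
    fix U :: "'a set" assume U: "open U" "x \<in> U"
    have "0 < emeasure M {x}" using x unfolding atoms_def by (simp add: emeasure_eq_measure)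
    also have "\<dots> \<le> emeasure M U" using U M(4) by (intro emeasure_mono) auto
    finally show "0 < emeasure M U" .
  qed
qed

lemma simplex_support:
  fixes M :: "'a::euclidean_space measure"
  assumes M: "prob_space M" "AE y in M. y \<in> S" "countable S" "sets M = sets borel"
    and ind: "\<not> affine_dependent (atoms M)" and full: "affine hull (atoms M) = UNIV"
  shows "card (msupport M) = DIM('a) + 1"
    and "\<exists>P. polytope P \<and> aff_dim P = int DIM('a) \<and> msupport M = {v. v extreme_point_of P}"
proof -
  have fin: "finite (atoms M)" using ind by (rule aff_independent_finite)
  have ms: "msupport M = atoms M" by (rule msupport_finite_atoms[OF M fin])
  have ad: "aff_dim (atoms M) = int DIM('a)" using full by (simp add: aff_dim_eq_full)
  show "card (msupport M) = DIM('a) + 1"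
    using aff_dim_affine_independent[OF ind] ad unfolding ms by simp
  show "\<exists>P. polytope P \<and> aff_dim P = int DIM('a) \<and> msupport M = {v. v extreme_point_of P}"
    unfolding ms
    using fin ad extreme_point_of_convex_hull_affine_independent[OF ind]
    by (intro exI[of _ "convex hull (atoms M)"]) (auto simp: polytope_convex_hull aff_dim_convex_hull)
qed

text \<open>
  Atoms that do not span have an affine basis \<open>B\<close>, and every hyperplane containing \<open>B\<close> contains the
  barycenter.  The functions \<open>l\<close> and \<open>k\<close> select one hyperplane for each \<open>B\<close>, so that countably many
  hyperplanes suffice for a countable \<open>S\<close>.
\<close>

lemma barycenter_off_hyperplanes_imp_full:
  fixes M :: "'a::euclidean_space measure"
  assumes M: "prob_space M" "AE y in M. y \<in> S" "countable S" "sets M = sets borel"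
    and bar: "has_barycenter M x"
    and l: "\<And>B. finite B \<Longrightarrow> B \<subseteq> S \<Longrightarrow> aff_dim B < int DIM('a) \<Longrightarrow> B \<subseteq> {y. l B \<bullet> y = k B} \<and> l B \<bullet> x \<noteq> k B"
  shows "affine hull (atoms M) = UNIV"
proof (rule ccontr)
  interpret prob_space M by fact
  assume n: "affine hull (atoms M) \<noteq> UNIV"
  obtain B where B: "B \<subseteq> atoms M" "\<not> affine_dependent B" "affine hull (atoms M) = affine hull B"
    using affine_basis_exists by metis
  have fin: "finite B" using B(2) by (rule aff_independent_finite)
  have BS: "B \<subseteq> S" using B(1) atoms_subset[OF M(2,4)] by auto
  have "aff_dim B \<noteq> int DIM('a)" using n B(3) by (simp add: aff_dim_eq_full)
  then have "aff_dim B < int DIM('a)" using aff_dim_le_DIM[of B] by simp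
  note lB = l[OF fin BS this]
  have "affine hull B \<subseteq> {y. l B \<bullet> y = k B}"
    using lB by (intro hull_minimal affine_hyperplane) auto
  then have T: "atoms M \<subseteq> {y. l B \<bullet> y = k B}" using B(3) hull_subset[of "atoms M" affine] by auto
  have "AE y in M. y \<bullet> l B = k B"
    using AE_atoms[OF M] by eventually_elim (use T in \<open>auto simp: inner_commute\<close>)
  then have "(LINT y|M. y \<bullet> l B) = (LINT y|M. k B)"
    using barycenter_inner(1)[OF bar] by (intro integral_cong_AE) auto
  then have "x \<bullet> l B = k B" using barycenter_inner(2)[OF bar] prob_space by simp
  then show False using lB by (simp add: inner_commute)
qed

lemma barycentric_weights_unique:
  fixes M N :: "'a::euclidean_space measure"
  assumes M: "prob_space M" "sets M = sets borel" "has_barycenter M x"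
    and N: "prob_space N" "sets N = sets borel" "has_barycenter N x"
    and T: "\<not> affine_dependent T" "AE y in M. y \<in> T" "AE y in N. y \<in> T"
  shows "M = N"
proof -
  have fin: "finite T" using T(1) by (rule aff_independent_finite)
  have wt: "(\<Sum>z\<in>T. measure P {z}) = 1" "(\<Sum>z\<in>T. measure P {z} *\<^sub>R z) = x"
    if P: "prob_space P" "sets P = sets borel" "has_barycenter P x" "AE y in P. y \<in> T" for P :: "'a measure"
  proof -
    interpret prob_space P by fact
    have hb: "has_bochner_integral P (\<lambda>y. \<Sum>z\<in>T. indicator {z} y *\<^sub>R f z) (\<Sum>z\<in>T. measure P {z} *\<^sub>R f z)"
      for f :: "'a \<Rightarrow> 'b::{banach, second_countable_topology}"
      using P(2) by (intro has_bochner_integral_sum has_bochner_integral_indicator) (auto simp: emeasure_eq_measure)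
    have ae: "AE y in P. (\<Sum>z\<in>T. indicator {z} y *\<^sub>R f z) = f y" for f :: "'a \<Rightarrow> 'b::{banach, second_countable_topology}"
      using P(4)
    proof eventually_elim
      case (elim y)
      have "(\<Sum>z\<in>T. indicator {z} y *\<^sub>R f z) = (\<Sum>z\<in>T. if z = y then f z else 0)"
        by (intro sum.cong refl) (auto split: split_indicator)
      then show ?case using fin elim by simp
    qed
    have I: "(LINT y|P. f y) = (\<Sum>z\<in>T. measure P {z} *\<^sub>R f z)"
      if "f \<in> borel_measurable P" for f :: "'a \<Rightarrow> 'b::{banach, second_countable_topology}"
    proof -
      have "(LINT y|P. f y) = (LINT y|P. (\<Sum>z\<in>T. indicator {z} y *\<^sub>R f z))"
        using hb[of f] ae[of f] that by (intro integral_cong_AE) (auto simp: has_bochner_integral_iff)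
      then show ?thesis using hb[of f] by (simp add: has_bochner_integral_iff)
    qed
    show "(\<Sum>z\<in>T. measure P {z}) = 1" using I[of "\<lambda>y. 1::real"] prob_space by simp
    show "(\<Sum>z\<in>T. measure P {z} *\<^sub>R z) = x"
      using I[of "\<lambda>y. y"] P(2,3) unfolding has_barycenter_def by auto
  qed
  define u where "u z = measure M {z} - measure N {z}" for z
  have "sum u T = 0" "(\<Sum>z\<in>T. u z *\<^sub>R z) = 0"
    unfolding u_def using wt[OF M T(2)] wt[OF N T(3)]
    by (auto simp: sum_subtractf scaleR_left_diff_distrib)
  then have u0: "u z = 0" if "z \<in> T" for z
    using T(1) that unfolding affine_dependent_explicit_finite[OF fin] by blast
  show ?thesis
  proof (rule measure_eqI_atoms[OF countable_finite[OF fin] M(2) N(2) T(2,3)])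
    fix z assume "z \<in> T"
    then show "emeasure M {z} = emeasure N {z}"
      using u0[of z] M(1) N(1) unfolding u_def
      by (simp add: finite_measure.emeasure_eq_measure prob_space.finite_measure)
  qed
qed

section \<open>Mixtures of plans\<close>

text \<open>
  The measure \<open>(M + N)/2\<close>, as the law of a draw from \<open>M\<close> or \<open>N\<close> decided by a fair coin.
\<close>

definition mix :: "'b measure \<Rightarrow> 'b measure \<Rightarrow> 'b measure" where
  "mix M N = measure_pmf (bernoulli_pmf (1/2)) \<bind> (\<lambda>b. if b then M else N)"

context
  fixes M N L :: "'b measure"
  assumes M: "prob_space M" "sets M = sets L" and N: "prob_space N" "sets N = sets L"
begin

lemma mix_kernel: "(\<lambda>b. if b then M else N) \<in> measure_pmf (bernoulli_pmf (1/2)) \<rightarrow>\<^sub>M prob_algebra L"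
  by (intro measurableI) (use M N in \<open>auto simp: space_prob_algebra\<close>)

lemma prob_mix: "prob_space (mix M N)" and sets_mix: "sets (mix M N) = sets L"
proof -
  have A: "measure_pmf (bernoulli_pmf (1/2)) \<in> space (prob_algebra (measure_pmf (bernoulli_pmf (1/2))))"
    by (simp add: space_prob_algebra prob_space_measure_pmf)
  show "prob_space (mix M N)" unfolding mix_def by (rule prob_space_bind'[OF A mix_kernel])
  show "sets (mix M N) = sets L" unfolding mix_def by (rule sets_bind'[OF A mix_kernel])
qed

lemma nn_integral_mix:
  assumes f: "f \<in> borel_measurable L"
  shows "(\<integral>\<^sup>+x. f x \<partial>mix M N) = (\<integral>\<^sup>+x. f x \<partial>M) / 2 + (\<integral>\<^sup>+x. f x \<partial>N) / 2"
proof -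
  have "(\<integral>\<^sup>+x. f x \<partial>mix M N) = (\<integral>\<^sup>+b. (\<integral>\<^sup>+x. f x \<partial>(if b then M else N)) \<partial>measure_pmf (bernoulli_pmf (1/2)))"
    unfolding mix_def by (rule nn_integral_bind[OF f measurable_prob_algebraD[OF mix_kernel]])
  also have "\<dots> = (\<integral>\<^sup>+x. f x \<partial>M) * ennreal (1/2) + (\<integral>\<^sup>+x. f x \<partial>N) * ennreal (1/2)"
    by (subst nn_integral_bernoulli_pmf) auto
  finally show ?thesis by (simp add: divide_ennreal_def ennreal_divide_numeral inverse_ennreal)
qed

lemma emeasure_mix:
  assumes X: "X \<in> sets L"
  shows "emeasure (mix M N) X = emeasure M X / 2 + emeasure N X / 2"
  using nn_integral_mix[of "indicator X"] X M(2) N(2) sets_mix by simp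

lemma integral_mix:
  fixes f :: "'b \<Rightarrow> real"
  assumes f: "integrable M f" "integrable N f"
  shows "integrable (mix M N) f" "(LINT x|mix M N. f x) = (LINT x|M. f x) / 2 + (LINT x|N. f x) / 2"
proof -
  have m: "f \<in> borel_measurable L" using f(1) measurable_cong_sets[OF M(2) refl] by auto
  have m': "f \<in> borel_measurable (mix M N)" using m measurable_cong_sets[OF sets_mix refl] by auto
  have fin: "(\<integral>\<^sup>+x. ennreal (g x) \<partial>P) \<noteq> \<infinity>" if "integrable P g" for P :: "'b measure" and g :: "'b \<Rightarrow> real"
    using real_integrable_def[of P g] that by simp
  have p: "(\<integral>\<^sup>+x. ennreal (f x) \<partial>mix M N) = (\<integral>\<^sup>+x. ennreal (f x) \<partial>M) / 2 + (\<integral>\<^sup>+x. ennreal (f x) \<partial>N) / 2"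
    using m by (intro nn_integral_mix) auto
  have n: "(\<integral>\<^sup>+x. ennreal (- f x) \<partial>mix M N) = (\<integral>\<^sup>+x. ennreal (- f x) \<partial>M) / 2 + (\<integral>\<^sup>+x. ennreal (- f x) \<partial>N) / 2"
    using m by (intro nn_integral_mix) auto
  have half: "a / 2 + b / 2 \<noteq> \<infinity>" "enn2real (a / 2 + b / 2) = enn2real a / 2 + enn2real b / 2"
    if "a \<noteq> \<infinity>" "b \<noteq> \<infinity>" for a b :: ennreal
  proof -
    obtain r s where rs: "a = ennreal r" "0 \<le> r" "b = ennreal s" "0 \<le> s"
      using \<open>a \<noteq> \<infinity>\<close> \<open>b \<noteq> \<infinity>\<close> by (cases a; cases b) auto
    have e: "a / 2 + b / 2 = ennreal (r / 2 + s / 2)"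
      using rs by (simp add: ennreal_divide_numeral)
    show "a / 2 + b / 2 \<noteq> \<infinity>" "enn2real (a / 2 + b / 2) = enn2real a / 2 + enn2real b / 2"
      unfolding e using rs by (simp_all del: ennreal_plus)
  qed
  have f1: "(\<integral>\<^sup>+x. ennreal (f x) \<partial>M) \<noteq> \<infinity>" "(\<integral>\<^sup>+x. ennreal (f x) \<partial>N) \<noteq> \<infinity>" by (rule fin[OF f(1)], rule fin[OF f(2)])
  have f2: "(\<integral>\<^sup>+x. ennreal (- f x) \<partial>M) \<noteq> \<infinity>" "(\<integral>\<^sup>+x. ennreal (- f x) \<partial>N) \<noteq> \<infinity>"
    by (rule fin[OF Bochner_Integration.integrable_minus[OF f(1)]], rule fin[OF Bochner_Integration.integrable_minus[OF f(2)]])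
  show i: "integrable (mix M N) f"
    unfolding real_integrable_def p n using m' half(1)[OF f1] half(1)[OF f2] by simp
  show "(LINT x|mix M N. f x) = (LINT x|M. f x) / 2 + (LINT x|N. f x) / 2"
    unfolding real_lebesgue_integral_def[OF i] real_lebesgue_integral_def[OF f(1)] real_lebesgue_integral_def[OF f(2)]
      p n half(2)[OF f1] half(2)[OF f2] by (simp add: field_simps)
qed

end

lemma barycenter_mix:
  fixes M N :: "'a::euclidean_space measure"
  assumes M: "prob_space M" "sets M = sets borel" and N: "prob_space N" "sets N = sets borel"
    and bar: "has_barycenter M x" "has_barycenter N x"
  shows "has_barycenter (mix M N) x"
proof -
  note im = integral_mix[OF M N]
  have i: "integrable (mix M N) (\<lambda>y. y \<bullet> b)" for b
    using bar by (intro im(1) barycenter_inner(1)) 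
  have "integrable (mix M N) (\<lambda>y::'a. \<Sum>b\<in>Basis. (y \<bullet> b) *\<^sub>R b)"
    using i by (intro Bochner_Integration.integrable_sum integrable_scaleR_left) auto
  then have ii: "integrable (mix M N) (\<lambda>y::'a. y)" by (simp add: euclidean_representation)
  have "(LINT y|mix M N. y) = x"
  proof (rule euclidean_eqI)
    fix b :: 'a
    have "(LINT y|mix M N. y) \<bullet> b = (LINT y|mix M N. y \<bullet> b)" using ii by simp
    also have "\<dots> = x \<bullet> b"
      using im(2)[OF barycenter_inner(1)[OF bar(1)] barycenter_inner(1)[OF bar(2)], of b]
        barycenter_inner(2)[OF bar(1), of b] barycenter_inner(2)[OF bar(2), of b] by simp
    finally show "(LINT y|mix M N. y) \<bullet> b = x \<bullet> b" .
  qed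
  with ii show ?thesis unfolding has_barycenter_def by simp
qed

lemma atoms_mix:
  fixes M N :: "'a::euclidean_space measure"
  assumes M: "prob_space M" "sets M = sets borel" and N: "prob_space N" "sets N = sets borel"
  shows "atoms M \<subseteq> atoms (mix M N)" "atoms N \<subseteq> atoms (mix M N)"
proof -
  interpret M: prob_space M by fact
  interpret N: prob_space N by fact
  interpret X: prob_space "mix M N" by (rule prob_mix[OF M N])
  have "emeasure (mix M N) {z} > 0" if "emeasure M {z} > 0 \<or> emeasure N {z} > 0" for z
    using that emeasure_mix[OF M N, of "{z}"]
    by (auto simp: zero_less_iff_neq_zero ennreal_divide_eq_0_iff)
  then show "atoms M \<subseteq> atoms (mix M N)" "atoms N \<subseteq> atoms (mix M N)"
    unfolding atoms_def by (auto simp: M.emeasure_eq_measure N.emeasure_eq_measure X.emeasure_eq_measure)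
qed

section \<open>Optimal plans\<close>

lemma (in disintegrated) kernel_concentrated:
  assumes S: "countable S" and ae: "AE y in distr \<pi> borel snd. y \<in> S"
  shows "AE x in \<mu>. AE y in \<kappa> x. y \<in> S"
proof -
  have "S \<in> sets borel" by (rule sets.countable[OF _ S]) simp
  then have Sm: "- S \<in> sets borel" by (simp add: borel_comp)
  have m: "snd \<in> \<pi> \<rightarrow>\<^sub>M borel"
    by (auto simp: measurable_cong_sets[OF sets_pi refl])
  have vs: "snd -` (- S) = (UNIV :: 'a set) \<times> (- S)" by auto
  have ae': "AE y in distr \<pi> borel snd. y \<notin> - S" using ae by simp
  have "- S \<in> null_sets (distr \<pi> borel snd)"
    using Sm by (intro AE_iff_null_sets[THEN iffD2, OF _ ae']) auto
  then have "emeasure (distr \<pi> borel snd) (- S) = 0" by auto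
  then have "emeasure \<pi> (UNIV \<times> - S) = 0"
    using emeasure_distr[OF m Sm] by (simp only: vs space_pi Int_UNIV_right)
  then have "(\<integral>\<^sup>+ x. emeasure (\<kappa> x) (- S) \<partial>\<mu>) = 0"
    using emeasure_rect[OF _ Sm, of UNIV] by simp
  then have "AE x in \<mu>. emeasure (\<kappa> x) (- S) = 0"
    using Sm by (subst (asm) nn_integral_0_iff_AE) auto
  then show ?thesis
  proof eventually_elim
    case (elim x)
    then have "- S \<in> null_sets (\<kappa> x)" using Sm by auto
    then show ?case using AE_not_in by fastforce
  qed
qed

text \<open>
  The null sets to discard are countable in number: \<open>S\<close> itself, one hyperplane for each finite subset of
  \<open>S\<close> that does not span, and for each circuit in \<open>S\<close> and each \<open>n\<close> the set \<open>E D n\<close> of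
  \<open>circuit_atoms_null\<close>.
\<close>

lemma (in disintegrated) optimal_kernel_simplex:
  assumes opt: "MT_optimal (power_cost p) \<mu> \<nu> Opt" "\<pi> \<in> Opt"
    and bar: "AE x in \<mu>. has_barycenter (\<kappa> x) x"
    and ac: "absolutely_continuous lborel \<mu>"
    and p: "p > 0" "p \<noteq> 2"
    and S: "countable S" "AE y in \<nu>. y \<in> S"
  shows "AE x in \<mu>. (AE y in \<kappa> x. y \<in> S) \<and> has_barycenter (\<kappa> x) x \<and>
    \<not> affine_dependent (atoms (\<kappa> x)) \<and> affine hull (atoms (\<kappa> x)) = UNIV"
proof -
  have snd: "distr \<pi> borel snd = \<nu>"
    using opt unfolding MT_optimal_def MT_minimizers_def MT_maximizers_def MT_def by auto
  have conc: "AE x in \<mu>. AE y in \<kappa> x. y \<in> S"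
    by (rule kernel_concentrated[OF S(1), unfolded snd, OF S(2)])
  have null: "AE x in \<mu>. x \<notin> X" if "X \<in> null_sets lborel" for X
    using that ac unfolding absolutely_continuous_def by (intro AE_not_in) auto
  have offS: "AE x in \<mu>. x \<notin> S" by (rule null[OF countable_imp_null_set_lborel[OF S(1)]])
  have cF: "countable {B. finite B \<and> B \<subseteq> S}" by (rule countable_Collect_finite_subset[OF S(1)])
  define E where "E D n = {x \<in> straddles D. norm x \<le> real n \<and> (\<forall>z\<in>D. 1 / real (Suc n) \<le> measure (\<kappa> x) {z})}" for D n
  have circ: "AE x in \<mu>. \<forall>D\<in>{B. finite B \<and> B \<subseteq> S}. \<forall>n. (\<exists>a. circuit D a) \<longrightarrow> x \<notin> E D n"
  proof (subst AE_ball_countable[OF cF], intro ballI)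
    fix D
    show "AE x in \<mu>. \<forall>n. (\<exists>a. circuit D a) \<longrightarrow> x \<notin> E D n"
    proof (cases "\<exists>a. circuit D a")
      case True
      then obtain a where a: "circuit D a" by blast
      have "E D n \<in> null_sets \<mu>" for n
        unfolding E_def by (rule circuit_atoms_null[OF opt bar ac p a]) simp
      then have "AE x in \<mu>. \<forall>n. x \<notin> E D n"
        by (subst AE_all_countable) (auto intro: AE_not_in)
      then show ?thesis by eventually_elim auto
    qed simp
  qed
  have "\<forall>B. \<exists>l k. aff_dim B < int DIM('a) \<longrightarrow> l \<noteq> 0 \<and> B \<subseteq> {y::'a. l \<bullet> y = k}"
  proof
    fix B :: "'a set"
    show "\<exists>l k. aff_dim B < int DIM('a) \<longrightarrow> l \<noteq> 0 \<and> B \<subseteq> {y::'a. l \<bullet> y = k}"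
    proof (cases "aff_dim B < int DIM('a)")
      case True
      then obtain l k where "l \<noteq> 0" "B \<subseteq> {y::'a. l \<bullet> y = k}" by (rule aff_lowdim_subset_hyperplane)
      then show ?thesis by blast
    qed simp
  qed
  then obtain l where "\<forall>B. \<exists>k. aff_dim B < int DIM('a) \<longrightarrow> l B \<noteq> 0 \<and> B \<subseteq> {y::'a. l B \<bullet> y = k}"
    by (rule choice[THEN exE])
  then obtain k where "\<forall>B. aff_dim B < int DIM('a) \<longrightarrow> l B \<noteq> 0 \<and> B \<subseteq> {y::'a. l B \<bullet> y = k B}"
    by (rule choice[THEN exE])
  then have lk: "\<And>B. aff_dim B < int DIM('a) \<Longrightarrow> l B \<noteq> 0 \<and> B \<subseteq> {y::'a. l B \<bullet> y = k B}" by blast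
  have hyp: "AE x in \<mu>. \<forall>B\<in>{B. finite B \<and> B \<subseteq> S}. aff_dim B < int DIM('a) \<longrightarrow> l B \<bullet> x \<noteq> k B"
  proof (subst AE_ball_countable[OF cF], intro ballI)
    fix B
    show "AE x in \<mu>. aff_dim B < int DIM('a) \<longrightarrow> l B \<bullet> x \<noteq> k B"
    proof (cases "aff_dim B < int DIM('a)")
      case True
      have "negligible {x. l B \<bullet> x = k B}" using lk[OF True] by (intro negligible_hyperplane) auto
      moreover have "{x. l B \<bullet> x = k B} \<in> sets lborel" using closed_hyperplane by simp
      ultimately have "{x. l B \<bullet> x = k B} \<in> null_sets lborel"
        unfolding negligible_iff_null_sets by (simp add: null_sets_completion_iff)
      from null[OF this] show ?thesis by eventually_elim auto
    qed simp
  qed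
  from conc bar offS circ hyp show ?thesis
  proof eventually_elim
    case (elim x)
    note M = prob_kernel[of x] elim(1) S(1) sets_kernel[of x]
    interpret k: prob_space "\<kappa> x" by (rule prob_kernel)
    have "affine hull (atoms (\<kappa> x)) = UNIV"
      by (rule barycenter_off_hyperplanes_imp_full[OF M elim(2), of l k]) (use elim(5) lk in auto)
    moreover have "\<not> affine_dependent (atoms (\<kappa> x))"
    proof
      assume "affine_dependent (atoms (\<kappa> x))"
      then obtain D a where D: "D \<subseteq> atoms (\<kappa> x)" "circuit D a" "x \<in> straddles D"
        using dependent_atoms_contain_straddling_circuit[OF M elim(2,3)] by blast
      have fin: "finite D" "D \<noteq> {}" using D(2) unfolding circuit_def by auto
      have DS: "D \<subseteq> S" using D(1) atoms_subset[OF elim(1) sets_kernel] by auto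
      define m where "m = Min ((\<lambda>z. measure (\<kappa> x) {z}) ` D)"
      have m0: "m > 0" unfolding m_def using fin D(1) by (subst Min_gr_iff) (auto simp: atoms_def)
      obtain n1 :: nat where n1: "1 / real (Suc n1) < m"
        using m0 reals_Archimedean[of m] by (auto simp: inverse_eq_divide)
      obtain n2 :: nat where n2: "norm x \<le> real n2" using real_arch_simple by blast
      define n where "n = max n1 n2"
      have "1 / real (Suc n) \<le> 1 / real (Suc n1)" unfolding n_def by (intro divide_left_mono) auto
      then have "1 / real (Suc n) \<le> m" using n1 by linarith
      then have "1 / real (Suc n) \<le> measure (\<kappa> x) {z}" if "z \<in> D" for z
        using fin that unfolding m_def by (meson Min_le finite_imageI imageI order_trans)
      moreover have "norm x \<le> real n" using n2 unfolding n_def by linarith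
      ultimately have "x \<in> E D n" using D(3) unfolding E_def by blast
      then show False using elim(4) fin DS D(2) by blast
    qed
    ultimately show ?case using elim by simp
  qed
qed

text \<open>
  On a countable \<open>S\<close> it suffices to compare the masses of single points, and \<open>x \<mapsto> \<kappa> x {z}\<close> is the
  density of the slice of \<open>\<pi>\<close> at \<open>z\<close>.
\<close>

lemma disintegration_AE_unique:
  assumes A: "disintegrated \<mu> \<pi> \<kappa>" and B: "disintegrated \<mu> \<pi> \<kappa>'"
    and S: "countable S" "AE y in distr \<pi> borel snd. y \<in> S"
  shows "AE x in \<mu>. \<kappa> x = \<kappa>' x"
proof -
  interpret A: disintegrated \<mu> \<pi> \<kappa> by (rule A)
  interpret B: disintegrated \<mu> \<pi> \<kappa>' by (rule B)
  interpret mu: prob_space \<mu> by (rule A.prob_mu)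
  have "AE x in \<mu>. \<forall>z\<in>S. emeasure (\<kappa> x) {z} = emeasure (\<kappa>' x) {z}"
  proof (subst AE_ball_countable[OF S(1)], intro ballI)
    fix z
    have "density \<mu> (\<lambda>x. emeasure (\<kappa> x) {z}) = density \<mu> (\<lambda>x. emeasure (\<kappa>' x) {z})"
      using A.distr_fst_atom[of z] B.distr_fst_atom[of z] by simp
    then show "AE x in \<mu>. emeasure (\<kappa> x) {z} = emeasure (\<kappa>' x) {z}"
      by (intro mu.density_unique) auto
  qed
  with A.kernel_concentrated[OF S] B.kernel_concentrated[OF S] show ?thesis
  proof eventually_elim
    case (elim x)
    then show ?case
      by (intro measure_eqI_atoms[OF S(1) A.sets_kernel B.sets_kernel]) auto
  qed
qed

lemma disintegrated_eqI:
  assumes A: "disintegrated \<mu> \<pi> \<kappa>" and B: "disintegrated \<mu> \<pi>' \<kappa>'"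
    and eq: "AE x in \<mu>. \<kappa> x = \<kappa>' x"
  shows "\<pi> = \<pi>'"
proof -
  interpret A: disintegrated \<mu> \<pi> \<kappa> by (rule A)
  interpret B: disintegrated \<mu> \<pi>' \<kappa>' by (rule B)
  interpret pi: prob_space \<pi> by (rule A.prob_pi)
  let ?E = "{A \<times> B | A B. A \<in> sets (borel :: 'a measure) \<and> B \<in> sets (borel :: 'a measure)}"
  have s: "sets (borel \<Otimes>\<^sub>M borel :: ('a \<times> 'a) measure) = sigma_sets UNIV ?E"
    by (simp add: sets_pair_measure)
  show ?thesis
  proof (rule measure_eqI_generator_eq[where E = ?E and \<Omega> = UNIV and A = "\<lambda>_. UNIV"])
    show "Int_stable ?E" by (rule Int_stable_pair_measure_generator)
    show "sets \<pi> = sigma_sets UNIV ?E" "sets \<pi>' = sigma_sets UNIV ?E"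
      using A.sets_pi B.sets_pi s by auto
    show "range (\<lambda>_. UNIV) \<subseteq> ?E"
      by (auto intro!: exI[of _ "UNIV :: 'a set"])
    fix X assume "X \<in> ?E"
    then obtain U V where X: "X = U \<times> V" "U \<in> sets borel" "V \<in> sets borel" by auto
    show "emeasure \<pi> X = emeasure \<pi>' X"
      unfolding X(1) A.emeasure_rect[OF X(2,3)] B.emeasure_rect[OF X(2,3)]
      using eq by (intro nn_integral_cong_AE) auto
  qed (auto simp: pi.emeasure_eq_measure)
qed

lemma mix_disintegrated:
  assumes A: "disintegrated \<mu> \<pi> \<kappa>" and B: "disintegrated \<mu> \<pi>' \<kappa>'"
  shows "disintegrated \<mu> (mix \<pi> \<pi>') (\<lambda>x. mix (\<kappa> x) (\<kappa>' x))"
proof -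
  interpret A: disintegrated \<mu> \<pi> \<kappa> by (rule A)
  interpret B: disintegrated \<mu> \<pi>' \<kappa>' by (rule B)
  note pm = A.prob_pi A.sets_pi B.prob_pi B.sets_pi
  note km = A.prob_kernel A.sets_kernel B.prob_kernel B.sets_kernel
  show ?thesis
  proof (intro disintegrated.intro A.prob_mu A.sets_mu prob_mix[OF pm] sets_mix[OF pm])
    show "disintegration \<mu> (mix \<pi> \<pi>') (\<lambda>x. mix (\<kappa> x) (\<kappa>' x))"
      unfolding disintegration_def
    proof (intro conjI ballI measurable_prob_algebraI measurable_subprob_algebra prob_space_imp_subprob_space prob_mix[OF km] sets_mix[OF km])
      fix V :: "'a set" assume V[measurable]: "V \<in> sets borel"
      show "(\<lambda>x. emeasure (mix (\<kappa> x) (\<kappa>' x)) V) \<in> borel_measurable borel"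
        unfolding emeasure_mix[OF km V] by measurable
      fix U :: "'a set" assume U[measurable]: "U \<in> sets borel"
      have UV: "U \<times> V \<in> sets (borel \<Otimes>\<^sub>M borel)" by measurable
      have d: "(a + b) / 2 = a / 2 + b / 2" for a b :: ennreal by (rule add_divide_distrib_ennreal)
      have "(\<integral>\<^sup>+ x. emeasure (mix (\<kappa> x) (\<kappa>' x)) V * indicator U x \<partial>\<mu>)
        = (\<integral>\<^sup>+ x. (emeasure (\<kappa> x) V * indicator U x) / 2 + (emeasure (\<kappa>' x) V * indicator U x) / 2 \<partial>\<mu>)"
        unfolding emeasure_mix[OF km V] by (intro nn_integral_cong) (auto split: split_indicator)
      also have "\<dots> = (\<integral>\<^sup>+ x. emeasure (\<kappa> x) V * indicator U x \<partial>\<mu>) / 2 + (\<integral>\<^sup>+ x. emeasure (\<kappa>' x) V * indicator U x \<partial>\<mu>) / 2"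
        by (subst nn_integral_add) (auto simp: nn_integral_divide)
      also have "\<dots> = emeasure (mix \<pi> \<pi>') (U \<times> V)"
        unfolding emeasure_mix[OF pm UV] A.emeasure_rect[OF U V] B.emeasure_rect[OF U V] ..
      finally show "emeasure (mix \<pi> \<pi>') (U \<times> V) = (\<integral>\<^sup>+ x. emeasure (mix (\<kappa> x) (\<kappa>' x)) V * indicator U x \<partial>\<mu>)" ..
    qed
  qed
qed

text \<open>
  The cost is linear in the plan and equal for both plans.
\<close>

lemma mix_optimal:
  assumes opt: "MT_optimal c \<mu> \<nu> Opt" "\<pi> \<in> Opt" "\<pi>' \<in> Opt"
    and c: "\<And>x y. 0 \<le> c x y" "(\<lambda>w. c (fst w) (snd w)) \<in> borel_measurable (borel \<Otimes>\<^sub>M borel)"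
    and A: "disintegrated \<mu> \<pi> \<kappa>" and B: "disintegrated \<mu> \<pi>' \<kappa>'"
    and bar: "AE x in \<mu>. has_barycenter (\<kappa> x) x" "AE x in \<mu>. has_barycenter (\<kappa>' x) x"
  shows "mix \<pi> \<pi>' \<in> Opt" "AE x in \<mu>. has_barycenter (mix (\<kappa> x) (\<kappa>' x)) x"
proof -
  interpret A: disintegrated \<mu> \<pi> \<kappa> by (rule A)
  interpret B: disintegrated \<mu> \<pi>' \<kappa>' by (rule B)
  interpret X: disintegrated \<mu> "mix \<pi> \<pi>'" "\<lambda>x. mix (\<kappa> x) (\<kappa>' x)" by (rule mix_disintegrated[OF A B])
  note pm = A.prob_pi A.sets_pi B.prob_pi B.sets_pi
  show bar': "AE x in \<mu>. has_barycenter (mix (\<kappa> x) (\<kappa>' x)) x"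
    using bar by eventually_elim (rule barycenter_mix[OF A.prob_kernel A.sets_kernel B.prob_kernel B.sets_kernel])
  have MT: "\<pi> \<in> MT \<mu> \<nu>" "\<pi>' \<in> MT \<mu> \<nu>" and fin: "\<bar>transport_cost c \<pi>\<bar> \<noteq> \<infinity>"
    and cost_le: "transport_cost c \<pi> = transport_cost c \<pi>'"
    using opt unfolding MT_optimal_def MT_minimizers_def MT_maximizers_def by (auto intro: antisym)
  have snd: "distr \<pi> borel snd = \<nu>" "distr \<pi>' borel snd = \<nu>" using MT unfolding MT_def by auto
  have half: "X / 2 + X / 2 = X" for X :: ennreal
    by (cases X) (simp_all add: ennreal_divide_numeral ennreal_top_divide flip: ennreal_plus)
  have sndX: "distr (mix \<pi> \<pi>') borel snd = \<nu>"
  proof (rule measure_eqI)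
    show "sets (distr (mix \<pi> \<pi>') borel snd) = sets \<nu>" using snd(1) by (metis sets_distr)
    fix V assume "V \<in> sets (distr (mix \<pi> \<pi>') borel snd)"
    then have V: "V \<in> sets borel" by simp
    have m: "snd \<in> P \<rightarrow>\<^sub>M borel" if "sets P = sets (borel \<Otimes>\<^sub>M borel)" for P :: "('a \<times> 'a) measure"
      by (auto simp: measurable_cong_sets[OF that refl])
    have vs: "snd -` V = (UNIV :: 'a set) \<times> V" by auto
    have UV: "UNIV \<times> V \<in> sets (borel \<Otimes>\<^sub>M borel)" using V by measurable
    have e: "emeasure (distr P borel snd) V = emeasure P (UNIV \<times> V)"
      if "sets P = sets (borel \<Otimes>\<^sub>M borel)" "space P = UNIV" for P :: "('a \<times> 'a) measure"
      using emeasure_distr[OF m[OF that(1)] V] that(2) by (simp only: vs Int_UNIV_right)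
    have "emeasure (distr (mix \<pi> \<pi>') borel snd) V = emeasure (distr \<pi> borel snd) V / 2 + emeasure (distr \<pi>' borel snd) V / 2"
      unfolding e[OF X.sets_pi X.space_pi] e[OF A.sets_pi A.space_pi] e[OF B.sets_pi B.space_pi]
      by (rule emeasure_mix[OF pm UV])
    then show "emeasure (distr (mix \<pi> \<pi>') borel snd) V = emeasure \<nu> V"
      unfolding snd half .
  qed
  have XMT: "mix \<pi> \<pi>' \<in> MT \<mu> \<nu>"
    unfolding MT_def using X.prob_pi X.sets_pi X.distr_fst sndX X.dis bar' by auto
  have "enn2ereal (\<integral>\<^sup>+w. ennreal (c (fst w) (snd w)) \<partial>\<pi>) = enn2ereal (\<integral>\<^sup>+w. ennreal (c (fst w) (snd w)) \<partial>\<pi>')"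
    using cost_le unfolding transport_cost_nonneg_cost[of c, OF c(1)] .
  then have ceq: "(\<integral>\<^sup>+w. ennreal (c (fst w) (snd w)) \<partial>\<pi>) = (\<integral>\<^sup>+w. ennreal (c (fst w) (snd w)) \<partial>\<pi>')"
    by (simp add: enn2ereal_inject)
  have "(\<integral>\<^sup>+w. ennreal (c (fst w) (snd w)) \<partial>mix \<pi> \<pi>') = (\<integral>\<^sup>+w. ennreal (c (fst w) (snd w)) \<partial>\<pi>)"
    using nn_integral_mix[OF pm, of "\<lambda>w. ennreal (c (fst w) (snd w))"] c(2) unfolding ceq half by simp
  then have "transport_cost c (mix \<pi> \<pi>') = transport_cost c \<pi>"
    unfolding transport_cost_nonneg_cost[of c, OF c(1)] by simp
  then show "mix \<pi> \<pi>' \<in> Opt"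
    using opt(1,2) XMT unfolding MT_optimal_def MT_minimizers_def MT_maximizers_def by auto
qed

text \<open>
  The atoms of the mixture \<open>(\<kappa> x + \<kappa>' x)/2\<close> are affinely independent and carry both \<open>\<kappa> x\<close> and
  \<open>\<kappa>' x\<close>, so both are given by the barycentric coordinates of \<open>x\<close>.
\<close>

lemma optimal_unique:
  assumes opt: "MT_optimal (power_cost p) \<mu> \<nu> Opt" "\<pi> \<in> Opt" "\<pi>' \<in> Opt"
    and A: "disintegrated \<mu> \<pi> \<kappa>" and B: "disintegrated \<mu> \<pi>' \<kappa>'"
    and bar: "AE x in \<mu>. has_barycenter (\<kappa> x) x" "AE x in \<mu>. has_barycenter (\<kappa>' x) x"
    and ac: "absolutely_continuous lborel \<mu>"
    and p: "p > 0" "p \<noteq> 2"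
    and S: "countable S" "AE y in \<nu>. y \<in> S"
  shows "\<pi> = \<pi>'"
proof (rule disintegrated_eqI[OF A B])
  interpret A: disintegrated \<mu> \<pi> \<kappa> by (rule A)
  interpret B: disintegrated \<mu> \<pi>' \<kappa>' by (rule B)
  interpret X: disintegrated \<mu> "mix \<pi> \<pi>'" "\<lambda>x. mix (\<kappa> x) (\<kappa>' x)" by (rule mix_disintegrated[OF A B])
  note km = A.prob_kernel A.sets_kernel B.prob_kernel B.sets_kernel
  have c: "0 \<le> power_cost p x y" for x y :: 'a unfolding power_cost_def by simp
  note mo = mix_optimal[OF opt c power_cost_measurable(1) A B bar]
  have snd: "distr \<pi> borel snd = \<nu>" "distr \<pi>' borel snd = \<nu>"
    using opt unfolding MT_optimal_def MT_minimizers_def MT_maximizers_def MT_def by auto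
  have "AE x in \<mu>. AE y in \<kappa> x. y \<in> S" "AE x in \<mu>. AE y in \<kappa>' x. y \<in> S"
    by (rule A.kernel_concentrated[OF S(1), unfolded snd, OF S(2)], rule B.kernel_concentrated[OF S(1), unfolded snd, OF S(2)])
  with X.optimal_kernel_simplex[OF opt(1) mo ac p S] bar
  show "AE x in \<mu>. \<kappa> x = \<kappa>' x"
  proof eventually_elim
    case (elim x)
    have "AE y in \<kappa> x. y \<in> atoms (mix (\<kappa> x) (\<kappa>' x))"
      using AE_atoms[OF A.prob_kernel elim(4) S(1) A.sets_kernel]
      by eventually_elim (use atoms_mix(1)[OF km] in blast)
    moreover have "AE y in \<kappa>' x. y \<in> atoms (mix (\<kappa> x) (\<kappa>' x))"
      using AE_atoms[OF B.prob_kernel elim(5) S(1) B.sets_kernel]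
      by eventually_elim (use atoms_mix(2)[OF km] in blast)
    ultimately show ?case
      using elim by (intro barycentric_weights_unique[OF A.prob_kernel A.sets_kernel _ B.prob_kernel B.sets_kernel]) auto
  qed
qed

theorem theorem2p15:
  fixes \<mu> \<nu> :: "(real ^ 'n) measure"
    and \<pi> :: "((real ^ 'n) \<times> (real ^ 'n)) measure"
    and Opt :: "((real ^ 'n) \<times> (real ^ 'n)) measure set"
    and p :: real
  assumes "p > 0" and "p \<noteq> 2"
    and "prob_space \<mu>" and "sets \<mu> = sets borel"
    and "prob_space \<nu>" and "sets \<nu> = sets borel"
    and "convex_order \<mu> \<nu>"
    and "absolutely_continuous lborel \<mu>"
    and "concentrated_on_countable \<nu>"
    and "Opt = MT_minimizers (power_cost p) \<mu> \<nu> \<or> Opt = MT_maximizers (power_cost p) \<mu> \<nu>"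
    and "\<pi> \<in> Opt"
  shows "(\<forall>\<kappa>. disintegration \<mu> \<pi> \<kappa> \<longrightarrow>
            (AE x in \<mu>. card (msupport (\<kappa> x)) = CARD('n) + 1 \<and>
               (\<exists>P. polytope P \<and> aff_dim P = int CARD('n) \<and>
                    msupport (\<kappa> x) = {v. v extreme_point_of P}))) \<and>
         (\<forall>\<pi>'\<in>Opt. \<pi>' = \<pi>)"
proof -
  have opt: "MT_optimal (power_cost p) \<mu> \<nu> Opt" using assms(10) unfolding MT_optimal_def .
  obtain S where S: "countable S" "AE y in \<nu>. y \<in> S"
    using assms(9) unfolding concentrated_on_countable_def by blast
  have plan: "\<exists>\<kappa>. disintegrated \<mu> \<rho> \<kappa> \<and> (AE x in \<mu>. has_barycenter (\<kappa> x) x)" "distr \<rho> borel snd = \<nu>"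
    "\<And>\<kappa>. disintegration \<mu> \<rho> \<kappa> \<Longrightarrow> disintegrated \<mu> \<rho> \<kappa>"
    if "\<rho> \<in> Opt" for \<rho>
  proof -
    have MT: "\<rho> \<in> MT \<mu> \<nu>"
      using that opt unfolding MT_optimal_def MT_minimizers_def MT_maximizers_def by auto
    show d: "disintegrated \<mu> \<rho> \<kappa>" if "disintegration \<mu> \<rho> \<kappa>" for \<kappa>
      using MT that assms(3,4) unfolding MT_def by (intro disintegrated.intro) auto
    show "\<exists>\<kappa>. disintegrated \<mu> \<rho> \<kappa> \<and> (AE x in \<mu>. has_barycenter (\<kappa> x) x)" "distr \<rho> borel snd = \<nu>"
      using MT d unfolding MT_def by auto
  qed
  obtain \<kappa>0 where k0: "disintegrated \<mu> \<pi> \<kappa>0" "AE x in \<mu>. has_barycenter (\<kappa>0 x) x"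
    using plan(1)[OF assms(11)] by blast
  show ?thesis
  proof (intro conjI allI impI ballI)
    fix \<kappa> assume "disintegration \<mu> \<pi> \<kappa>"
    then have k: "disintegrated \<mu> \<pi> \<kappa>" by (rule plan(3)[OF assms(11)])
    interpret K: disintegrated \<mu> \<pi> \<kappa>0 by (rule k0(1))
    have "AE x in \<mu>. \<kappa>0 x = \<kappa> x"
      using S plan(2)[OF assms(11)] by (intro disintegration_AE_unique[OF k0(1) k, of S]) auto
    with K.optimal_kernel_simplex[OF opt assms(11) k0(2) assms(8,1,2) S]
    show "AE x in \<mu>. card (msupport (\<kappa> x)) = CARD('n) + 1 \<and>
               (\<exists>P. polytope P \<and> aff_dim P = int CARD('n) \<and>
                    msupport (\<kappa> x) = {v. v extreme_point_of P})"
    proof eventually_elim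
      case (elim x)
      have "card (msupport (\<kappa>0 x)) = DIM(real ^ 'n) + 1"
        "\<exists>P. polytope P \<and> aff_dim P = int DIM(real ^ 'n) \<and> msupport (\<kappa>0 x) = {v. v extreme_point_of P}"
        using elim(1) by (intro simplex_support[OF K.prob_kernel _ S(1) K.sets_kernel]; simp)+
      then show ?case using elim(2) by simp
    qed
  next
    fix \<pi>' assume pi': "\<pi>' \<in> Opt"
    obtain \<kappa>' where k': "disintegrated \<mu> \<pi>' \<kappa>'" "AE x in \<mu>. has_barycenter (\<kappa>' x) x"
      using plan(1)[OF pi'] by blast
    show "\<pi>' = \<pi>"
      by (rule optimal_unique[OF opt pi' assms(11) k'(1) k0(1) k'(2) k0(2) assms(8,1,2) S])
  qed
qed

end
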